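(* Let $\mathcal L$ be a filter algebra and let $\mathcal L_{sB}$ be the set of all Boolean filters of $\mathcal L$, ordered by reverse inclusion. Then: (a) $\mathcal L_{sB}$ contains $\{\mathbf 1\}$ and is closed under the operations join (which, for reverse inclusion, is $\mathcal G\cap\mathcal K$) and $\Delta$ (that is, $\Delta(\mathcal G,\mathcal F)\in\mathcal L_{sB}$ whenever $\mathcal G\subseteq\mathcal F$ are in $\mathcal L_{sB}$). (b) $\mathcal L_{sB}$, with greatest element $\{\mathbf 1\}$, this join and $\Delta$, is an atomic MR-algebra. (c) The mapping $e:\mathcal L\to\mathcal L_{sB}$, $g\mapsto[g,\mathbf 1]$, is a full embedding. (d) The atoms of $\mathcal L_{sB}$ are exactly the g-filters of $\mathcal L$.
   Context: **Cubic algebras.** A cubic algebra is a join semilattice $\mathcal L$ with greatest element $\mathbf 1$ and an operation $\Delta(y,x)$ (used only for $x\le y$) such that: (a) $x\le y$ implies $\Delta(y,x)\vee x=y$; (b) $x\le y\le z$ implies $\Delta(z,\Delta(y,x))=\Delta(\Delta(z,y),\Delta(z,x))$; (c) $x\le y$ implies $\Delta(y,\Delta(y,x))=x$; (d) $x\le y\le z$ implies $\Delta(z,x)\le\Delta(z,y)$; and, writing $xy:=\Delta(\mathbf 1,\Delta(x\vee y,y))\vee y$, (e) $(xy)y=x\vee y$; (f) $x(yz)=y(xz)$. A meet $x\wedge y$ is the greatest lower bound, which need not exist. An MR-algebra is a cubic algebra such that for all $a,b<x$: $\Delta(x,a)\vee b<x$ iff $a\wedge b$ does not exist. An atom (vertex)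 is a minimal element; the algebra is atomic if every element lies above an atom. A cubic embedding is an injective map preserving $\mathbf 1$, join and $\Delta$; a cubic embedding $f:\mathcal L\to\mathcal M$ is full iff for every $m<\mathbf 1$ in $\mathcal M$ there is $l<\mathbf 1$ in $\mathcal L$ with $m\le f(l)$. **Filter algebras.** An implication algebra is (equivalently) a join semilattice with $1$ in which each interval $[a,1]$ is a Boolean algebra; $a\to b$ is the complement of $a\vee b$ in $[b,1]$. It is an implication lattice if all binary meets exist. For an implication algebra $I$, $\mathscr I(I)=\{\langle a,b\rangle : a,b\in I,\ a\vee b=1,\ a\wedge b\text{ exists}\}$ with componentwise order and join, $\mathbf 1=\langle 1,1\rangle$, and $\Delta(\langle a,b\rangle,\langle c,d\rangle)=\langle a\wedge(b\to d),\,b\wedge(a\to c)\rangle$ for $\langle c,d\rangle\le\langle a,b\rangle$. A filter algebra is a cubic algebra isomorphic to $\mathscr I(I)$ for some implication lattice $I$; every filter algebra is an MR-algebra. **Filters.** A filter in $\mathcal L$ is a nonempty upward closed subset in which any two elements have a meet that again lies in the subset. $[g,\mathbf 1]=\{x: x\ge g\}$. For a filter $\mathcal F$, $[[\mathcal F]]$ is the cubic subalgebra it generates (it equals $\{\Delta(x,y): y\le x,\ x,y\in\mathcal F\}$). $\mathcal F$ is a g-filter of $\mathcal L$ if $[[\mathcal F]]=\mathcal L$. If $\mathcal F\cup\mathcal G$ has the finite intersection property (finite subsets have meets), $\mathcal F\vee\mathcal G=\{f\wedge g: f\in\mathcal F,g\in\mathcal G\}$ is the filter generated by $\mathcal F\cup\mathcal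 G$. $\Delta(\mathbf 1,\mathcal F)=\{\Delta(\mathbf 1,f):f\in\mathcal F\}$. **Operations on filters.** For filters $\mathcal G\subseteq\mathcal F$: $\mathcal G\to\mathcal F=\{h\in\mathcal F:\forall g\in\mathcal G,\ h\vee g=\mathbf 1\}$ and $\Delta(\mathcal G,\mathcal F)=\Delta(\mathbf 1,\mathcal G\to\mathcal F)\vee\mathcal G$ (this join of filters always exists). **Boolean filters.** $\mathcal G$ is $\mathcal F$-Boolean iff $\mathcal G\subseteq\mathcal F$ and $\mathcal G\vee(\mathcal G\to\mathcal F)=\mathcal F$. A filter $\mathcal G$ is Boolean iff there is some g-filter of $\mathcal L$ containing $\mathcal G$ and $\mathcal G$ is $\mathcal H$-Boolean for every g-filter $\mathcal H\supseteq\mathcal G$. *)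

theory Defs
  imports "HOL-Algebra.Lattice"
begin

section \<open>Cubic algebras and MR-algebras\<close>

text \<open>Joins, meets and the greatest element are those of the carrier order. Only the values
  \<open>\<Delta> y x\<close> with \<open>x \<sqsubseteq> y\<close> are meaningful.\<close>

record 'a cubic = "'a gorder" +
  Delta :: "'a \<Rightarrow> 'a \<Rightarrow> 'a" (\<open>\<Delta>\<index>\<close>)

text \<open>The product \<open>xy\<close>.\<close>

definition cubic_mult :: "('a, 'm) cubic_scheme \<Rightarrow> 'a \<Rightarrow> 'a \<Rightarrow> 'a" (infixl \<open>\<cdot>\<index>\<close> 75)
  where "x \<cdot>\<^bsub>L\<^esub> y = \<Delta>\<^bsub>L\<^esub> \<top>\<^bsub>L\<^esub> (\<Delta>\<^bsub>L\<^esub> (x \<squnion>\<^bsub>L\<^esub> y) y) \<squnion>\<^bsub>L\<^esub> y"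

locale cubic_algebra = upper_semilattice L + weak_partial_order_top L
  for L :: "('a, 'm) cubic_scheme" (structure) +
  assumes Delta_closed:
      "\<lbrakk>x \<in> carrier L; y \<in> carrier L; x \<sqsubseteq> y\<rbrakk> \<Longrightarrow> \<Delta> y x \<in> carrier L"
    and Delta_join:
      "\<lbrakk>x \<in> carrier L; y \<in> carrier L; x \<sqsubseteq> y\<rbrakk> \<Longrightarrow> \<Delta> y x \<squnion> x = y"
    and Delta_Delta:
      "\<lbrakk>x \<in> carrier L; y \<in> carrier L; z \<in> carrier L; x \<sqsubseteq> y; y \<sqsubseteq> z\<rbrakk>
        \<Longrightarrow> \<Delta> z (\<Delta> y x) = \<Delta> (\<Delta> z y) (\<Delta> z x)"
    and Delta_involution:
      "\<lbrakk>x \<in> carrier L; y \<in> carrier L; x \<sqsubseteq> y\<rbrakk> \<Longrightarrow> \<Delta> y (\<Delta> y x) = x"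
    and Delta_mono:
      "\<lbrakk>x \<in> carrier L; y \<in> carrier L; z \<in> carrier L; x \<sqsubseteq> y; y \<sqsubseteq> z\<rbrakk>
        \<Longrightarrow> \<Delta> z x \<sqsubseteq> \<Delta> z y"
    and mult_mult_right:
      "\<lbrakk>x \<in> carrier L; y \<in> carrier L\<rbrakk> \<Longrightarrow> (x \<cdot> y) \<cdot> y = x \<squnion> y"
    and mult_left_commute:
      "\<lbrakk>x \<in> carrier L; y \<in> carrier L; z \<in> carrier L\<rbrakk>
        \<Longrightarrow> x \<cdot> (y \<cdot> z) = y \<cdot> (x \<cdot> z)"

locale mr_algebra = cubic_algebra L for L :: "('a, 'm) cubic_scheme" (structure) +
  assumes mr:
    "\<lbrakk>x \<in> carrier L; a \<in> carrier L; b \<in> carrier L; a \<sqsubset> x; b \<sqsubset> x\<rbrakk>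
      \<Longrightarrow> \<Delta> x a \<squnion> b \<sqsubset> x \<longleftrightarrow> \<not> (\<exists>m. is_glb L m {a, b})"

definition atom :: "('a, 'm) gorder_scheme \<Rightarrow> 'a \<Rightarrow> bool"
  where "atom L a \<longleftrightarrow> a \<in> carrier L \<and> (\<forall>x\<in>carrier L. x \<sqsubseteq>\<^bsub>L\<^esub> a \<longrightarrow> x = a)"

definition atomic :: "('a, 'm) gorder_scheme \<Rightarrow> bool"
  where "atomic L \<longleftrightarrow> (\<forall>x\<in>carrier L. \<exists>a. atom L a \<and> a \<sqsubseteq>\<^bsub>L\<^esub> x)"

definition cubic_embedding ::
    "('a, 'm) cubic_scheme \<Rightarrow> ('b, 'n) cubic_scheme \<Rightarrow> ('a \<Rightarrow> 'b) \<Rightarrow> bool"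
  where "cubic_embedding L M f \<longleftrightarrow>
    f \<in> carrier L \<rightarrow> carrier M \<and> inj_on f (carrier L) \<and>
    f \<top>\<^bsub>L\<^esub> = \<top>\<^bsub>M\<^esub> \<and>
    (\<forall>x\<in>carrier L. \<forall>y\<in>carrier L. f (x \<squnion>\<^bsub>L\<^esub> y) = f x \<squnion>\<^bsub>M\<^esub> f y) \<and>
    (\<forall>x\<in>carrier L. \<forall>y\<in>carrier L. x \<sqsubseteq>\<^bsub>L\<^esub> y \<longrightarrow>
      f (\<Delta>\<^bsub>L\<^esub> y x) = \<Delta>\<^bsub>M\<^esub> (f y) (f x))"

definition full_cubic_embedding ::
    "('a, 'm) cubic_scheme \<Rightarrow> ('b, 'n) cubic_scheme \<Rightarrow> ('a \<Rightarrow> 'b) \<Rightarrow> bool"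
  where "full_cubic_embedding L M f \<longleftrightarrow> cubic_embedding L M f \<and>
    (\<forall>m\<in>carrier M. m \<sqsubset>\<^bsub>M\<^esub> \<top>\<^bsub>M\<^esub> \<longrightarrow>
      (\<exists>l\<in>carrier L. l \<sqsubset>\<^bsub>L\<^esub> \<top>\<^bsub>L\<^esub> \<and> m \<sqsubseteq>\<^bsub>M\<^esub> f l))"

definition cubic_iso ::
    "('a, 'm) cubic_scheme \<Rightarrow> ('b, 'n) cubic_scheme \<Rightarrow> ('a \<Rightarrow> 'b) \<Rightarrow> bool"
  where "cubic_iso L M f \<longleftrightarrow> cubic_embedding L M f \<and> f ` carrier L = carrier M"


section \<open>Implication algebras and filter algebras\<close>

locale boolean_lattice = bounded_lattice L for L (structure) +
  assumes meet_join_distrib: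
      "\<lbrakk>x \<in> carrier L; y \<in> carrier L; z \<in> carrier L\<rbrakk>
        \<Longrightarrow> x \<sqinter> (y \<squnion> z) = (x \<sqinter> y) \<squnion> (x \<sqinter> z)"
    and complement_exists:
      "x \<in> carrier L \<Longrightarrow> \<exists>y\<in>carrier L. x \<squnion> y = \<top> \<and> x \<sqinter> y = \<bottom>"

definition complement :: "('a, 'm) gorder_scheme \<Rightarrow> 'a \<Rightarrow> 'a"
  where "complement B x =
    (THE y. y \<in> carrier B \<and> x \<squnion>\<^bsub>B\<^esub> y = \<top>\<^bsub>B\<^esub> \<and> x \<sqinter>\<^bsub>B\<^esub> y = \<bottom>\<^bsub>B\<^esub>)"

text \<open>\<open>up_set L a\<close> is the interval from \<open>a\<close> to the greatest element.\<close>

definition up_set :: "('a, 'm) gorder_scheme \<Rightarrow> 'a \<Rightarrow> 'a set"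
  where "up_set L a = {x \<in> carrier L. a \<sqsubseteq>\<^bsub>L\<^esub> x}"

definition up_interval :: "('a, 'm) gorder_scheme \<Rightarrow> 'a \<Rightarrow> ('a, 'm) gorder_scheme"
  where "up_interval L a = L\<lparr>carrier := up_set L a\<rparr>"

locale implication_algebra = upper_semilattice L + weak_partial_order_top L
  for L (structure) +
  assumes interval_boolean: "a \<in> carrier L \<Longrightarrow> boolean_lattice (up_interval L a)"

locale implication_lattice = implication_algebra L + lower_semilattice L
  for L (structure)

definition impl :: "('a, 'm) gorder_scheme \<Rightarrow> 'a \<Rightarrow> 'a \<Rightarrow> 'a"
  where "impl L a b = complement (up_interval L b) (a \<squnion>\<^bsub>L\<^esub> b)"

definition pair_algebra :: "('i, 'm) gorder_scheme \<Rightarrow> ('i \<times> 'i) cubic"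
  where "pair_algebra I =
    \<lparr>carrier = {(a, b). a \<in> carrier I \<and> b \<in> carrier I \<and>
        a \<squnion>\<^bsub>I\<^esub> b = \<top>\<^bsub>I\<^esub> \<and> (\<exists>m. is_glb I m {a, b})},
     eq = (=),
     le = (\<lambda>(a, b) (c, d). a \<sqsubseteq>\<^bsub>I\<^esub> c \<and> b \<sqsubseteq>\<^bsub>I\<^esub> d),
     Delta = (\<lambda>(a, b) (c, d). (a \<sqinter>\<^bsub>I\<^esub> impl I b d, b \<sqinter>\<^bsub>I\<^esub> impl I a c))\<rparr>"

text \<open>The type \<open>'i\<close> hosts the implication lattice, since HOL cannot quantify over types inside
  a formula.\<close>

definition filter_algebra :: "'i itself \<Rightarrow> ('a, 'm) cubic_scheme \<Rightarrow> bool"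
  where "filter_algebra TYPE('i) L \<longleftrightarrow> cubic_algebra L \<and>
    (\<exists>I :: 'i gorder. implication_lattice I \<and> (\<exists>f. cubic_iso L (pair_algebra I) f))"


section \<open>Filters\<close>

definition cubic_filter :: "('a, 'm) gorder_scheme \<Rightarrow> 'a set \<Rightarrow> bool"
  where "cubic_filter L F \<longleftrightarrow> F \<subseteq> carrier L \<and> F \<noteq> {} \<and>
    (\<forall>x\<in>F. \<forall>y\<in>carrier L. x \<sqsubseteq>\<^bsub>L\<^esub> y \<longrightarrow> y \<in> F) \<and>
    (\<forall>x\<in>F. \<forall>y\<in>F. \<exists>m\<in>F. is_glb L m {x, y})"

definition cubic_subalgebra :: "('a, 'm) cubic_scheme \<Rightarrow> 'a set \<Rightarrow> bool"
  where "cubic_subalgebra L S \<longleftrightarrow> S \<subseteq> carrier L \<and> \<top>\<^bsub>L\<^esub> \<in> S \<and>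
    (\<forall>x\<in>S. \<forall>y\<in>S. x \<squnion>\<^bsub>L\<^esub> y \<in> S) \<and>
    (\<forall>x\<in>S. \<forall>y\<in>S. x \<sqsubseteq>\<^bsub>L\<^esub> y \<longrightarrow> \<Delta>\<^bsub>L\<^esub> y x \<in> S)"

definition generated_subalgebra :: "('a, 'm) cubic_scheme \<Rightarrow> 'a set \<Rightarrow> 'a set"
  where "generated_subalgebra L F = \<Inter>{S. cubic_subalgebra L S \<and> F \<subseteq> S}"

definition g_filter :: "('a, 'm) cubic_scheme \<Rightarrow> 'a set \<Rightarrow> bool"
  where "g_filter L F \<longleftrightarrow> cubic_filter L F \<and> generated_subalgebra L F = carrier L"

text \<open>\<open>\<F> \<or> \<G>\<close>, the set of all meets \<open>f \<and> g\<close>. Stated through \<open>is_glb\<close>, because the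
  library's meet is an unspecified element when no greatest lower bound exists.\<close>

definition filter_join :: "('a, 'm) gorder_scheme \<Rightarrow> 'a set \<Rightarrow> 'a set \<Rightarrow> 'a set"
  where "filter_join L F G = {m. \<exists>f\<in>F. \<exists>g\<in>G. is_glb L m {f, g}}"

definition filter_imp :: "('a, 'm) gorder_scheme \<Rightarrow> 'a set \<Rightarrow> 'a set \<Rightarrow> 'a set"
  where "filter_imp L G F = {h \<in> F. \<forall>g\<in>G. h \<squnion>\<^bsub>L\<^esub> g = \<top>\<^bsub>L\<^esub>}"

definition filter_Delta :: "('a, 'm) cubic_scheme \<Rightarrow> 'a set \<Rightarrow> 'a set \<Rightarrow> 'a set"
  where "filter_Delta L G F =
    filter_join L (\<Delta>\<^bsub>L\<^esub> \<top>\<^bsub>L\<^esub> ` filter_imp L G F) G"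

definition relatively_boolean :: "('a, 'm) gorder_scheme \<Rightarrow> 'a set \<Rightarrow> 'a set \<Rightarrow> bool"
  where "relatively_boolean L F G \<longleftrightarrow>
    G \<subseteq> F \<and> filter_join L G (filter_imp L G F) = F"

definition boolean_filter :: "('a, 'm) cubic_scheme \<Rightarrow> 'a set \<Rightarrow> bool"
  where "boolean_filter L G \<longleftrightarrow> cubic_filter L G \<and>
    (\<exists>H. g_filter L H \<and> G \<subseteq> H) \<and>
    (\<forall>H. g_filter L H \<and> G \<subseteq> H \<longrightarrow> relatively_boolean L H G)"

text \<open>The Boolean filters under reverse inclusion. If \<open>\<F>\<close> lies below \<open>\<G>\<close>, then
  \<open>\<G> \<subseteq> \<F>\<close>, which is when \<open>filter_Delta L \<G> \<F>\<close> is meaningful.\<close>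

definition boolean_filter_algebra :: "('a, 'm) cubic_scheme \<Rightarrow> 'a set cubic"
  where "boolean_filter_algebra L =
    \<lparr>carrier = {G. boolean_filter L G}, eq = (=), le = (\<lambda>F G. G \<subseteq> F),
     Delta = filter_Delta L\<rparr>"

end

theory Submission
  imports Defs "HOL-Analysis.Sigma_Algebra"
begin

text \<open>
  The proof is Stone duality. Prime filters represent an implication lattice, upside down, as a
  ring \<open>R\<close> of sets (\<open>prime_filter_separates\<close>, \<open>ring_of_sets_stone\<close>): meets are unions, joins are
  intersections and \<open>a \<rightarrow> b\<close> is the difference of \<open>b\<close> and \<open>a\<close>. An element \<open>\<langle>a, b\<rangle>\<close> of the filter algebra
  consists of two disjoint sets, and is here read as one signed set in which the points of \<open>a\<close> carry
  the sign \<open>True\<close> and those of \<open>b\<close> the sign \<open>False\<close>. In signed sets the order is reverse inclusion,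
  the join is intersection, a meet is a union and exists iff no point gets both signs, \<open>\<Delta> Y Z\<close> changes
  the signs on \<open>Z - Y\<close>, and the product of \<open>Y\<close> and \<open>Z\<close> is \<open>Z - Y\<close>. The axioms of an MR-algebra then hold
  point by point, over every ring of sets (\<open>signed_mr_algebra\<close>).

  Call a set \<open>U \<subseteq> \<Union>R\<close> local if it meets each member of \<open>R\<close> in a member of \<open>R\<close>. The local sets again form
  a ring of sets, and a local signed set \<open>Z\<close> gives the filter of all elements whose signed set lies
  in \<open>Z\<close>. The heart of the proof is that these filters are exactly the Boolean ones
  (\<open>boolean_filter_filter_of\<close>, \<open>boolean_filter_obtain\<close>), and that the g-filters are those for which \<open>Z\<close>
  signs every point of \<open>\<Union>R\<close> (\<open>g_filter_filter_of\<close>, \<open>g_filter_obtain_spanning\<close>). Given such a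
  filter, the task is to see that the union of its signed sets is local, that is, over each member of
  \<open>R\<close> it is described by one element of the filter. For a g-filter this holds because the
  elements whose points are all signed by one member of the filter form a subalgebra; for a Boolean
  filter, because each element of a g-filter above it is a meet of an element of the Boolean filter
  and an element disjoint from all of it.

  On such filters \<open>\<G> \<rightarrow> \<F>\<close>, the join of filters and \<open>\<Delta>(\<G>, \<F>)\<close> are the difference, the union and the \<open>\<Delta>\<close> of
  the signed sets. Therefore the Boolean filters are isomorphic to the signed sets over the
  ring of local sets, and everything is visible there: the algebra is an MR-algebra; its
  atoms are the signed sets that sign every point; each signed set extends to such a one by giving
  the sign \<open>True\<close> to all remaining points; and \<open>g \<mapsto> [g, \<top>]\<close> is the inclusion of the signed sets over \<open>R\<close>
  in those over the local sets.
\<close>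

section \<open>The cubic algebra of signed sets\<close>

definition slice :: "('p \<times> bool) set \<Rightarrow> bool \<Rightarrow> 'p set"
  where "slice Z b = {p. (p, b) \<in> Z}"

definition flip :: "('p \<times> bool) set \<Rightarrow> ('p \<times> bool) set"
  where "flip Z = {(p, b). (p, \<not> b) \<in> Z}"

definition consistent :: "('p \<times> bool) set \<Rightarrow> bool"
  where "consistent Z \<longleftrightarrow> (\<forall>p b. (p, b) \<in> Z \<longrightarrow> (p, \<not> b) \<notin> Z)"

text \<open>A point carries one of two signs, so a signed set is a subset of \<open>'p \<times> bool\<close>; keeping it as one set
  rather than as a pair of sets makes join, meet and \<open>\<Delta>\<close> plain set operations.\<close>

definition signed_sets :: "'p set set \<Rightarrow> ('p \<times> bool) set set"
  where "signed_sets R = {Z. consistent Z \<and> (\<forall>b. slice Z b \<in> R)}"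

text \<open>Reverse inclusion makes \<open>{}\<close> the greatest element. \<open>\<Delta> Y Z\<close> is the reflection of the face \<open>Z\<close> inside
  the cube \<open>Y\<close>: the coordinates fixed by \<open>Y\<close> stay, the further ones fixed by \<open>Z\<close> change sign.\<close>

definition signed_algebra :: "'p set set \<Rightarrow> ('p \<times> bool) set cubic"
  where "signed_algebra R =
    \<lparr>carrier = signed_sets R, eq = (=), le = (\<lambda>Y Z. Z \<subseteq> Y),
     Delta = (\<lambda>Y Z. Y \<union> flip (Z - Y))\<rparr>"

lemma mem_flip_iff [simp]: "(p, b) \<in> flip Z \<longleftrightarrow> (p, \<not> b) \<in> Z"
  by (simp add: flip_def)

lemma mem_slice_iff [simp]: "p \<in> slice Z b \<longleftrightarrow> (p, b) \<in> Z"
  by (simp add: slice_def)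

lemma flip_empty [simp]: "flip {} = {}"
  by (simp add: flip_def)

lemma flip_flip [simp]: "flip (flip Z) = Z"
  by auto

lemma consistent_subset: "consistent Z \<Longrightarrow> Y \<subseteq> Z \<Longrightarrow> consistent Y"
  by (auto simp: consistent_def)

lemma consistent_Diff: "consistent Y \<Longrightarrow> consistent (Y - Z)"
  by (erule consistent_subset) blast

lemma consistent_Int: "consistent Y \<Longrightarrow> consistent (Y \<inter> Z)"
  by (erule consistent_subset) blast

lemma consistent_flip: "consistent Z \<Longrightarrow> consistent (flip Z)"
  by (auto simp: consistent_def)

lemma consistent_times: "consistent (A \<times> {c})"
  by (auto simp: consistent_def)

lemma signed_setsD: "Z \<in> signed_sets R \<Longrightarrow> (p, b) \<in> Z \<Longrightarrow> (p, \<not> b) \<notin> Z"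
  by (auto simp: signed_sets_def consistent_def)

lemma signed_consistent: "Z \<in> signed_sets R \<Longrightarrow> consistent Z"
  by (simp add: signed_sets_def)

lemma slice_set_ops:
  "slice {} b = {}"
  "slice (Y \<union> Z) b = slice Y b \<union> slice Z b"
  "slice (Y \<inter> Z) b = slice Y b \<inter> slice Z b"
  "slice (Y - Z) b = slice Y b - slice Z b"
  "slice (flip Z) b = slice Z (\<not> b)"
  by auto

lemma slice_eqI: "(\<And>b. slice Y b = slice Z b) \<Longrightarrow> Y = Z"
  by (auto simp: slice_def set_eq_iff)

lemma slice_times: "slice (A \<times> {c}) b = (if b = c then A else {})"
  by auto

lemma signed_algebra_simps [simp]:
  "carrier (signed_algebra R) = signed_sets R"
  "eq (signed_algebra R) = (=)"
  "le (signed_algebra R) Y Z \<longleftrightarrow> Z \<subseteq> Y"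
  "\<Delta>\<^bsub>signed_algebra R\<^esub> Y Z = Y \<union> flip (Z - Y)"
  by (simp_all add: signed_algebra_def)

context ring_of_sets
begin

lemma empty_signed: "{} \<in> signed_sets M"
  by (simp add: signed_sets_def consistent_def slice_set_ops)

lemma Int_signed: "Y \<in> signed_sets M \<Longrightarrow> Z \<in> signed_sets M \<Longrightarrow> Y \<inter> Z \<in> signed_sets M"
  by (auto simp: signed_sets_def slice_set_ops consistent_Int)

lemma Diff_signed: "Y \<in> signed_sets M \<Longrightarrow> Z \<in> signed_sets M \<Longrightarrow> Y - Z \<in> signed_sets M"
  by (auto simp: signed_sets_def slice_set_ops consistent_Diff)

lemma Un_signed:
  "Y \<in> signed_sets M \<Longrightarrow> Z \<in> signed_sets M \<Longrightarrow> consistent (Y \<union> Z) \<Longrightarrow> Y \<union> Z \<in> signed_sets M"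
  by (auto simp: signed_sets_def slice_set_ops)

lemma flip_signed: "Z \<in> signed_sets M \<Longrightarrow> flip Z \<in> signed_sets M"
  by (auto simp: signed_sets_def slice_set_ops consistent_flip)

lemma times_signed: "A \<in> M \<Longrightarrow> A \<times> {b} \<in> signed_sets M"
  by (simp add: signed_sets_def slice_times consistent_times)

lemma Delta_signed:
  assumes "Z \<in> signed_sets M" "Y \<in> signed_sets M" "Y \<subseteq> Z"
  shows "Y \<union> flip (Z - Y) \<in> signed_sets M"
proof (rule Un_signed)
  show "consistent (Y \<union> flip (Z - Y))"
    using assms by (auto simp: signed_sets_def consistent_def)
qed (use assms in \<open>auto intro: flip_signed Diff_signed\<close>)

lemma signed_is_lub:
  assumes "Y \<in> signed_sets M" "Z \<in> signed_sets M"
  shows "is_lub (signed_algebra M) (Y \<inter> Z) {Y, Z}"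
  using assms by (auto simp: least_def Upper_def intro: Int_signed)

lemma signed_partial_order: "partial_order (signed_algebra M)"
  by unfold_locales auto

lemma signed_upper_semilattice: "upper_semilattice (signed_algebra M)"
proof -
  interpret partial_order "signed_algebra M"
    by (rule signed_partial_order)
  show ?thesis
    using signed_is_lub by unfold_locales auto
qed

lemma signed_join:
  assumes "Y \<in> signed_sets M" "Z \<in> signed_sets M"
  shows "Y \<squnion>\<^bsub>signed_algebra M\<^esub> Z = Y \<inter> Z"
proof -
  interpret upper_semilattice "signed_algebra M"
    by (rule signed_upper_semilattice)
  show ?thesis
    using joinI[of Y Z "\<lambda>s. s = Y \<inter> Z"] least_unique signed_is_lub[OF assms] assms by simp
qed

lemma signed_greatest: "greatest (signed_algebra M) {} (carrier (signed_algebra M))"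
  by (simp add: greatest_def empty_signed)

lemma signed_top: "\<top>\<^bsub>signed_algebra M\<^esub> = {}"
proof -
  interpret partial_order "signed_algebra M"
    by (rule signed_partial_order)
  show ?thesis
    unfolding top_def using signed_greatest greatest_unique by (intro some_equality) auto
qed

text \<open>The sign changes in the definition of the product cancel on \<open>Z - Y\<close>, while on \<open>Y \<inter> Z\<close> exactly one of
  them survives and is removed by the final join. The product is therefore set difference, which
  makes the two axioms on it identities of sets.\<close>

lemma signed_mult:
  assumes Y: "Y \<in> signed_sets M" and Z: "Z \<in> signed_sets M"
  shows "Y \<cdot>\<^bsub>signed_algebra M\<^esub> Z = Z - Y"
proof -
  have "flip ((Y \<inter> Z) \<union> flip (Z - (Y \<inter> Z))) \<in> signed_sets M"
    by (intro flip_signed Delta_signed Int_signed Y Z) auto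
  then have "Y \<cdot>\<^bsub>signed_algebra M\<^esub> Z = flip ((Y \<inter> Z) \<union> flip (Z - (Y \<inter> Z))) \<inter> Z"
    using Y Z by (simp add: cubic_mult_def signed_join signed_top)
  also have "\<dots> = Z - Y"
    using Z by (auto dest: signed_setsD)
  finally show ?thesis .
qed

text \<open>A lower bound contains both sets, so its consistency forces that of the union; a meet thus exists
  exactly when no point has opposite signs in the two sets.\<close>

lemma signed_is_glb_iff:
  assumes "Y \<in> signed_sets M" "Z \<in> signed_sets M"
  shows "is_glb (signed_algebra M) W {Y, Z} \<longleftrightarrow> W \<in> signed_sets M \<and> W = Y \<union> Z"
proof
  assume W: "is_glb (signed_algebra M) W {Y, Z}"
  then have "W \<in> signed_sets M" "Y \<union> Z \<subseteq> W"
    using assms by (auto simp: greatest_def Lower_def)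
  moreover from this have "Y \<union> Z \<in> signed_sets M"
    using assms by (intro Un_signed) (auto simp: signed_sets_def intro: consistent_subset)
  then have "W \<subseteq> Y \<union> Z"
    using W assms by (auto simp: greatest_def Lower_def)
  ultimately show "W \<in> signed_sets M \<and> W = Y \<union> Z"
    by blast
qed (use assms in \<open>auto simp: greatest_def Lower_def\<close>)

text \<open>For the defining equivalence of MR-algebras: both conditions say that some point has opposite
  signs in \<open>Y\<close> and \<open>Z\<close>. Such a point lies outside \<open>X\<close>, since \<open>X\<close> is contained in both, and
  after the reflection of \<open>Y\<close> in \<open>X\<close> it is one that the join with \<open>Z\<close> retains.\<close>

theorem signed_mr_algebra: "mr_algebra (signed_algebra M)"
proof -
  interpret upper_semilattice "signed_algebra M"
    by (rule signed_upper_semilattice)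
  interpret weak_partial_order_top "signed_algebra M"
    using signed_greatest by unfold_locales blast
  show ?thesis
  proof (unfold_locales, simp_all only: signed_algebra_simps)
    fix Y Z assume A: "Y \<in> signed_sets M" "Z \<in> signed_sets M" "Z \<subseteq> Y"
    show D: "Z \<union> flip (Y - Z) \<in> signed_sets M"
      using A by (rule Delta_signed)
    show "(Z \<union> flip (Y - Z)) \<squnion>\<^bsub>signed_algebra M\<^esub> Y = Z"
      using A D by (auto simp: signed_join dest: signed_setsD)
    show "Z \<union> flip (Z \<union> flip (Y - Z) - Z) = Y"
      using A by (auto dest: signed_setsD)
  next
    fix X Y Z assume "X \<in> signed_sets M" "Y \<in> signed_sets M" "Z \<in> signed_sets M" "Y \<subseteq> X" "Z \<subseteq> Y"
    then show "Z \<union> flip (Y \<union> flip (X - Y) - Z) =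
        Z \<union> flip (Y - Z) \<union> flip (Z \<union> flip (X - Z) - (Z \<union> flip (Y - Z)))"
      and "Z \<union> flip (Y - Z) \<subseteq> Z \<union> flip (X - Z)"
      by (auto dest: signed_setsD)
  next
    fix Y Z assume "Y \<in> signed_sets M" "Z \<in> signed_sets M"
    then show "(Y \<cdot>\<^bsub>signed_algebra M\<^esub> Z) \<cdot>\<^bsub>signed_algebra M\<^esub> Z = Y \<squnion>\<^bsub>signed_algebra M\<^esub> Z"
      by (auto simp: signed_mult signed_join Diff_signed)
  next
    fix X Y Z assume "X \<in> signed_sets M" "Y \<in> signed_sets M" "Z \<in> signed_sets M"
    then show "X \<cdot>\<^bsub>signed_algebra M\<^esub> (Y \<cdot>\<^bsub>signed_algebra M\<^esub> Z) =
        Y \<cdot>\<^bsub>signed_algebra M\<^esub> (X \<cdot>\<^bsub>signed_algebra M\<^esub> Z)"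
      by (auto simp: signed_mult Diff_signed)
  next
    fix X Y Z assume A: "X \<in> signed_sets M" "Y \<in> signed_sets M" "Z \<in> signed_sets M"
      and lt: "Y \<sqsubset>\<^bsub>signed_algebra M\<^esub> X" "Z \<sqsubset>\<^bsub>signed_algebra M\<^esub> X"
    from lt have le: "X \<subseteq> Y" "X \<subseteq> Z"
      by (auto simp: lless_def)
    have "X \<union> flip (Y - X) \<in> signed_sets M"
      using A le by (intro Delta_signed)
    then have "(X \<union> flip (Y - X)) \<squnion>\<^bsub>signed_algebra M\<^esub> Z = X \<union> (flip (Y - X) \<inter> Z)"
      using A le by (auto simp: signed_join)
    then have "(X \<union> flip (Y - X)) \<squnion>\<^bsub>signed_algebra M\<^esub> Z \<sqsubset>\<^bsub>signed_algebra M\<^esub> X \<longleftrightarrow>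
        \<not> flip (Y - X) \<inter> Z \<subseteq> X"
      by (auto simp: lless_eq)
    also have "\<dots> \<longleftrightarrow> \<not> consistent (Y \<union> Z)"
    proof -
      have Y: "(p, \<not> b) \<notin> Y" if "(p, b) \<in> Y" for p b
        using A(2) that by (rule signed_setsD)
      have Z: "(p, \<not> b) \<notin> Z" if "(p, b) \<in> Z" for p b
        using A(3) that by (rule signed_setsD)
      have "flip (Y - X) \<inter> Z \<subseteq> X \<longleftrightarrow> (\<forall>p b. (p, b) \<in> Z \<longrightarrow> (p, \<not> b) \<notin> Y)"
      proof (intro iffI allI impI notI subsetI)
        fix p b assume H: "flip (Y - X) \<inter> Z \<subseteq> X" and p: "(p, b) \<in> Z" "(p, \<not> b) \<in> Y"
        from p have "(p, b) \<in> flip (Y - X) \<inter> Z"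
          using Z le by auto
        then show False
          using H le Y p by blast
      next
        fix q assume "\<forall>p b. (p, b) \<in> Z \<longrightarrow> (p, \<not> b) \<notin> Y" "q \<in> flip (Y - X) \<inter> Z"
        then show "q \<in> X"
          by (cases q) auto
      qed
      also have "\<dots> \<longleftrightarrow> consistent (Y \<union> Z)"
        using Y[of _ True] Z[of _ True] by (auto simp: consistent_def all_bool_eq)
      finally show ?thesis
        by simp
    qed
    also have "\<dots> \<longleftrightarrow> Y \<union> Z \<notin> signed_sets M"
      using A by (auto simp: signed_sets_def slice_set_ops)
    also have "\<dots> \<longleftrightarrow> \<not> (\<exists>m. is_glb (signed_algebra M) m {Y, Z})"
      using A by (auto simp: signed_is_glb_iff)
    finally show "(X \<union> flip (Y - X)) \<squnion>\<^bsub>signed_algebra M\<^esub> Z \<sqsubset>\<^bsub>signed_algebra M\<^esub> X \<longleftrightarrow>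
        \<not> (\<exists>m. is_glb (signed_algebra M) m {Y, Z})" .
  qed
qed

end

section \<open>Isomorphisms of cubic algebras\<close>

lemma is_glb_pair_iff:
  assumes "x \<in> carrier L" "y \<in> carrier L"
  shows "is_glb L m {x, y} \<longleftrightarrow> m \<in> carrier L \<and> m \<sqsubseteq>\<^bsub>L\<^esub> x \<and> m \<sqsubseteq>\<^bsub>L\<^esub> y \<and>
    (\<forall>l\<in>carrier L. l \<sqsubseteq>\<^bsub>L\<^esub> x \<and> l \<sqsubseteq>\<^bsub>L\<^esub> y \<longrightarrow> l \<sqsubseteq>\<^bsub>L\<^esub> m)"
  using assms unfolding greatest_def Lower_def by blast

lemma is_lub_pair_iff:
  assumes "x \<in> carrier L" "y \<in> carrier L"
  shows "is_lub L m {x, y} \<longleftrightarrow> m \<in> carrier L \<and> x \<sqsubseteq>\<^bsub>L\<^esub> m \<and> y \<sqsubseteq>\<^bsub>L\<^esub> m \<and>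
    (\<forall>u\<in>carrier L. x \<sqsubseteq>\<^bsub>L\<^esub> u \<and> y \<sqsubseteq>\<^bsub>L\<^esub> u \<longrightarrow> m \<sqsubseteq>\<^bsub>L\<^esub> u)"
  using assms unfolding least_def Upper_def by blast

lemma (in upper_semilattice) join_is_lub:
  assumes "x \<in> carrier L" "y \<in> carrier L"
  shows "is_lub L (x \<squnion> y) {x, y}"
  by (rule joinI[where P = "\<lambda>s. is_lub L s {x, y}"]) (use assms in auto)

lemma (in upper_semilattice) join_eqI:
  assumes "is_lub L s {x, y}" "x \<in> carrier L" "y \<in> carrier L"
  shows "x \<squnion> y = s"
  using join_is_lub[OF assms(2,3)] assms(1) by (rule least_unique)

lemma (in upper_semilattice) le_iff_join_eq:
  assumes "x \<in> carrier L" "y \<in> carrier L"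
  shows "x \<sqsubseteq> y \<longleftrightarrow> x \<squnion> y = y"
proof
  assume "x \<sqsubseteq> y"
  then have "is_lub L y {x, y}"
    using assms by (simp add: is_lub_pair_iff)
  then show "x \<squnion> y = y"
    using assms by (rule join_eqI)
next
  assume "x \<squnion> y = y"
  then show "x \<sqsubseteq> y"
    using join_left[OF assms] by simp
qed

text \<open>An isomorphism is required to preserve the order in both directions, not the join, so that it can
  be stated before the existence of joins is known on both sides. Closure under \<open>\<Delta>\<close> is required on the
  source; it then holds on the target, and the notion is symmetric.\<close>

locale cubic_order_iso =
  fixes M :: "('a, 'm) cubic_scheme" and N :: "('b, 'n) cubic_scheme" and e :: "'a \<Rightarrow> 'b"
  assumes bij: "bij_betw e (carrier M) (carrier N)"
    and le_iff: "\<lbrakk>x \<in> carrier M; y \<in> carrier M\<rbrakk> \<Longrightarrow> e x \<sqsubseteq>\<^bsub>N\<^esub> e y \<longleftrightarrow> x \<sqsubseteq>\<^bsub>M\<^esub> y"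
    and Delta_in: "\<lbrakk>x \<in> carrier M; y \<in> carrier M; x \<sqsubseteq>\<^bsub>M\<^esub> y\<rbrakk> \<Longrightarrow> \<Delta>\<^bsub>M\<^esub> y x \<in> carrier M"
    and Delta_hom: "\<lbrakk>x \<in> carrier M; y \<in> carrier M; x \<sqsubseteq>\<^bsub>M\<^esub> y\<rbrakk>
      \<Longrightarrow> e (\<Delta>\<^bsub>M\<^esub> y x) = \<Delta>\<^bsub>N\<^esub> (e y) (e x)"
begin

lemma carrier_image: "carrier N = e ` carrier M"
  using bij by (simp add: bij_betw_def)

lemma e_in: "x \<in> carrier M \<Longrightarrow> e x \<in> carrier N"
  by (simp add: carrier_image)

lemma e_eq_iff: "\<lbrakk>x \<in> carrier M; y \<in> carrier M\<rbrakk> \<Longrightarrow> e x = e y \<longleftrightarrow> x = y"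
  using bij by (auto simp: bij_betw_def inj_on_def)

lemma inverse: "cubic_order_iso N M (inv_into (carrier M) e)"
proof -
  let ?g = "inv_into (carrier M) e"
  have ge: "?g (e x) = x" if "x \<in> carrier M" for x
    using bij that by (simp add: bij_betw_def)
  show ?thesis
    by unfold_locales
      (use bij_betw_inv_into[OF bij] in
        \<open>auto simp: carrier_image ge le_iff Delta_in simp flip: Delta_hom\<close>)
qed

lemma is_lub_iff:
  assumes "s \<in> carrier M" "x \<in> carrier M" "y \<in> carrier M"
  shows "is_lub N (e s) {e x, e y} \<longleftrightarrow> is_lub M s {x, y}"
  using assms by (simp add: is_lub_pair_iff e_in) (simp add: carrier_image le_iff)

lemma is_glb_iff:
  assumes "s \<in> carrier M" "x \<in> carrier M" "y \<in> carrier M"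
  shows "is_glb N (e s) {e x, e y} \<longleftrightarrow> is_glb M s {x, y}"
  using assms by (simp add: is_glb_pair_iff e_in) (simp add: carrier_image le_iff)

lemma greatest_carrier_iff:
  assumes "s \<in> carrier M"
  shows "greatest N (e s) (carrier N) \<longleftrightarrow> greatest M s (carrier M)"
  using assms by (auto simp: greatest_def carrier_image le_iff)

lemma partial_order_transfer:
  assumes "partial_order M" and "eq N = (=)"
  shows "partial_order N"
proof -
  interpret M: partial_order M by fact
  show ?thesis
    by unfold_locales
      (auto simp: assms(2) carrier_image le_iff dest: M.le_antisym intro: M.le_trans)
qed

lemma upper_semilattice_transfer:
  assumes "upper_semilattice M" and "eq N = (=)"
  shows "upper_semilattice N"
proof -
  interpret M: upper_semilattice M by fact
  interpret N: partial_order N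
    by (rule partial_order_transfer) (fact M.partial_order_axioms, fact)
  show ?thesis
  proof
    fix X Y assume "X \<in> carrier N" "Y \<in> carrier N"
    then obtain x y where xy: "x \<in> carrier M" "y \<in> carrier M" "X = e x" "Y = e y"
      by (auto simp: carrier_image)
    moreover from xy obtain s where "is_lub M s {x, y}"
      using M.sup_of_two_exists by blast
    ultimately show "\<exists>s. is_lub N s {X, Y}"
      using is_lub_iff least_closed by metis
  qed
qed

lemma join_hom:
  assumes "upper_semilattice M" and "eq N = (=)" and xy: "x \<in> carrier M" "y \<in> carrier M"
  shows "e (x \<squnion>\<^bsub>M\<^esub> y) = e x \<squnion>\<^bsub>N\<^esub> e y"
proof -
  interpret M: upper_semilattice M by fact
  interpret N: upper_semilattice N
    by (rule upper_semilattice_transfer) fact+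
  have "is_lub N (e (x \<squnion>\<^bsub>M\<^esub> y)) {e x, e y}"
    using xy M.join_is_lub by (simp add: is_lub_iff)
  then show ?thesis
    using N.join_eqI e_in xy by metis
qed

lemma mr_algebra_transfer:
  assumes "mr_algebra M" and eq: "eq N = (=)"
  shows "mr_algebra N"
proof -
  interpret M: mr_algebra M by fact
  have us: "upper_semilattice M" ..
  interpret N: upper_semilattice N
    by (rule upper_semilattice_transfer) fact+
  have gN: "greatest N (e \<top>\<^bsub>M\<^esub>) (carrier N)"
    using M.top_greatest greatest_carrier_iff by blast
  interpret N: weak_partial_order_top N
    using gN by unfold_locales blast
  have top_hom: "\<top>\<^bsub>N\<^esub> = e \<top>\<^bsub>M\<^esub>"
    using gN N.top_greatest N.greatest_unique by blast
  note join = join_hom[OF us eq, symmetric]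
  note hom = Delta_hom[symmetric]
  have mult_in: "x \<cdot>\<^bsub>M\<^esub> y \<in> carrier M" if "x \<in> carrier M" "y \<in> carrier M" for x y
    using that unfolding cubic_mult_def by (simp add: M.Delta_closed M.join_right)
  have mult_hom: "e x \<cdot>\<^bsub>N\<^esub> e y = e (x \<cdot>\<^bsub>M\<^esub> y)" if "x \<in> carrier M" "y \<in> carrier M" for x y
    using that unfolding cubic_mult_def by (simp add: join hom top_hom M.Delta_closed M.join_right)
  have lless_hom: "e x \<sqsubset>\<^bsub>N\<^esub> e y \<longleftrightarrow> x \<sqsubset>\<^bsub>M\<^esub> y" if "x \<in> carrier M" "y \<in> carrier M" for x y
    using that by (simp add: M.lless_eq N.lless_eq le_iff e_eq_iff)
  have glb_hom: "(\<exists>m. is_glb N m {e x, e y}) \<longleftrightarrow> (\<exists>m. is_glb M m {x, y})"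
    if "x \<in> carrier M" "y \<in> carrier M" for x y
  proof
    assume "\<exists>m. is_glb N m {e x, e y}"
    then obtain m where m: "is_glb N m {e x, e y}"
      by blast
    then have "m \<in> carrier N"
      by (rule greatest_closed)
    then obtain m' where "m' \<in> carrier M" "m = e m'"
      by (auto simp: carrier_image)
    then show "\<exists>m. is_glb M m {x, y}"
      using m is_glb_iff[of m' x y] that by auto
  next
    assume "\<exists>m. is_glb M m {x, y}"
    then obtain m where m: "is_glb M m {x, y}"
      by blast
    then have "m \<in> carrier M"
      by (rule greatest_closed)
    then show "\<exists>m. is_glb N m {e x, e y}"
      using m is_glb_iff[of m x y] that by auto
  qed
  have Delta_below: "\<Delta>\<^bsub>M\<^esub> y x \<sqsubseteq>\<^bsub>M\<^esub> y" if "x \<in> carrier M" "y \<in> carrier M" "x \<sqsubseteq>\<^bsub>M\<^esub> y" for x y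
    using M.Delta_join[OF that] M.join_left[of "\<Delta>\<^bsub>M\<^esub> y x" x] M.Delta_closed that by simp
  note closed = M.Delta_closed Delta_below
  show ?thesis
  proof
    fix X Y assume A: "X \<in> carrier N" "Y \<in> carrier N" "X \<sqsubseteq>\<^bsub>N\<^esub> Y"
    then obtain x y where xy: "x \<in> carrier M" "y \<in> carrier M" "X = e x" "Y = e y" "x \<sqsubseteq>\<^bsub>M\<^esub> y"
      by (auto simp: carrier_image le_iff)
    then show "\<Delta>\<^bsub>N\<^esub> Y X \<in> carrier N" "\<Delta>\<^bsub>N\<^esub> Y X \<squnion>\<^bsub>N\<^esub> X = Y" "\<Delta>\<^bsub>N\<^esub> Y (\<Delta>\<^bsub>N\<^esub> Y X) = X"
      by (simp_all add: hom join closed e_in M.Delta_join M.Delta_involution)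
  next
    fix X Y Z
    assume A: "X \<in> carrier N" "Y \<in> carrier N" "Z \<in> carrier N" "X \<sqsubseteq>\<^bsub>N\<^esub> Y" "Y \<sqsubseteq>\<^bsub>N\<^esub> Z"
    then obtain x y z where xyz: "x \<in> carrier M" "y \<in> carrier M" "z \<in> carrier M"
        "X = e x" "Y = e y" "Z = e z" "x \<sqsubseteq>\<^bsub>M\<^esub> y" "y \<sqsubseteq>\<^bsub>M\<^esub> z"
      by (auto simp: carrier_image le_iff)
    then have "x \<sqsubseteq>\<^bsub>M\<^esub> z"
      using M.le_trans[of x y z] by simp
    moreover have "\<Delta>\<^bsub>M\<^esub> y x \<sqsubseteq>\<^bsub>M\<^esub> z"
      using xyz closed M.le_trans[of "\<Delta>\<^bsub>M\<^esub> y x" y z] by simp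
    ultimately show "\<Delta>\<^bsub>N\<^esub> Z (\<Delta>\<^bsub>N\<^esub> Y X) = \<Delta>\<^bsub>N\<^esub> (\<Delta>\<^bsub>N\<^esub> Z Y) (\<Delta>\<^bsub>N\<^esub> Z X)"
      and "\<Delta>\<^bsub>N\<^esub> Z X \<sqsubseteq>\<^bsub>N\<^esub> \<Delta>\<^bsub>N\<^esub> Z Y"
      using xyz by (simp_all add: hom closed le_iff M.Delta_Delta M.Delta_mono)
  next
    fix X Y assume "X \<in> carrier N" "Y \<in> carrier N"
    then show "(X \<cdot>\<^bsub>N\<^esub> Y) \<cdot>\<^bsub>N\<^esub> Y = X \<squnion>\<^bsub>N\<^esub> Y"
      by (auto simp: carrier_image mult_hom mult_in join M.mult_mult_right)
  next
    fix X Y Z assume "X \<in> carrier N" "Y \<in> carrier N" "Z \<in> carrier N"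
    then show "X \<cdot>\<^bsub>N\<^esub> (Y \<cdot>\<^bsub>N\<^esub> Z) = Y \<cdot>\<^bsub>N\<^esub> (X \<cdot>\<^bsub>N\<^esub> Z)"
      by (auto simp: carrier_image mult_hom mult_in e_eq_iff intro: M.mult_left_commute)
  next
    fix X A B
    assume A: "X \<in> carrier N" "A \<in> carrier N" "B \<in> carrier N" "A \<sqsubset>\<^bsub>N\<^esub> X" "B \<sqsubset>\<^bsub>N\<^esub> X"
    then obtain x a b where xab: "x \<in> carrier M" "a \<in> carrier M" "b \<in> carrier M"
        "X = e x" "A = e a" "B = e b" "a \<sqsubset>\<^bsub>M\<^esub> x" "b \<sqsubset>\<^bsub>M\<^esub> x"
      by (auto simp: carrier_image lless_hom)
    then have "a \<sqsubseteq>\<^bsub>M\<^esub> x"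
      by (simp add: M.lless_eq)
    then show "\<Delta>\<^bsub>N\<^esub> X A \<squnion>\<^bsub>N\<^esub> B \<sqsubset>\<^bsub>N\<^esub> X \<longleftrightarrow> \<not> (\<exists>m. is_glb N m {A, B})"
      using xab M.mr[of x a b] by (simp add: hom join closed lless_hom glb_hom)
  qed
qed

end

text \<open>Since \<open>x \<sqsubseteq> y\<close> iff \<open>x \<squnion> y = y\<close>, an injective join homomorphism reflects the order. The target has to
  be a semilattice: joins are defined by choice, and only then are they least upper bounds.\<close>

lemma cubic_order_iso_of_cubic_iso:
  assumes "cubic_algebra L" and "upper_semilattice M" and f: "cubic_iso L M f"
  shows "cubic_order_iso L M f"
proof -
  interpret L: cubic_algebra L by fact
  interpret M: upper_semilattice M by fact
  have inj: "inj_on f (carrier L)" and im: "f ` carrier L = carrier M"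
    and join: "\<And>x y. x \<in> carrier L \<Longrightarrow> y \<in> carrier L \<Longrightarrow> f (x \<squnion>\<^bsub>L\<^esub> y) = f x \<squnion>\<^bsub>M\<^esub> f y"
    using f by (auto simp: cubic_iso_def cubic_embedding_def)
  show ?thesis
  proof
    show "bij_betw f (carrier L) (carrier M)"
      using inj im by (simp add: bij_betw_def)
    fix x y assume xy: "x \<in> carrier L" "y \<in> carrier L"
    then have "f x \<in> carrier M" "f y \<in> carrier M"
      using im by auto
    then have "f x \<sqsubseteq>\<^bsub>M\<^esub> f y \<longleftrightarrow> f (x \<squnion>\<^bsub>L\<^esub> y) = f y"
      using xy by (simp add: M.le_iff_join_eq join)
    also have "\<dots> \<longleftrightarrow> x \<squnion>\<^bsub>L\<^esub> y = y"
      using inj xy by (simp add: inj_on_eq_iff)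
    finally show "f x \<sqsubseteq>\<^bsub>M\<^esub> f y \<longleftrightarrow> x \<sqsubseteq>\<^bsub>L\<^esub> y"
      using xy L.le_iff_join_eq by simp
    assume le: "x \<sqsubseteq>\<^bsub>L\<^esub> y"
    show "\<Delta>\<^bsub>L\<^esub> y x \<in> carrier L"
      using xy le by (intro L.Delta_closed)
    show "f (\<Delta>\<^bsub>L\<^esub> y x) = \<Delta>\<^bsub>M\<^esub> (f y) (f x)"
      using f xy le by (auto simp: cubic_iso_def cubic_embedding_def)
  qed
qed

lemma cubic_order_iso_comp:
  assumes "cubic_order_iso L M f" "cubic_order_iso M N g"
  shows "cubic_order_iso L N (g \<circ> f)"
proof -
  interpret f: cubic_order_iso L M f by fact
  interpret g: cubic_order_iso M N g by fact
  show ?thesis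
    by unfold_locales
      (use bij_betw_trans[OF f.bij g.bij] in
        \<open>simp_all add: f.e_in g.le_iff f.le_iff f.Delta_in f.Delta_hom g.Delta_hom\<close>)
qed

section \<open>Stone representation of implication lattices\<close>

context implication_lattice
begin

lemma up_interval_simps [simp]:
  "carrier (up_interval L a) = up_set L a"
  "eq (up_interval L a) = eq L"
  "le (up_interval L a) = le L"
  by (simp_all add: up_interval_def)

lemma mem_up_set: "x \<in> up_set L a \<longleftrightarrow> x \<in> carrier L \<and> a \<sqsubseteq> x"
  by (simp add: up_set_def)

lemma meet_is_glb:
  assumes "x \<in> carrier L" "y \<in> carrier L"
  shows "is_glb L (x \<sqinter> y) {x, y}"
  by (rule meetI[where P = "\<lambda>s. is_glb L s {x, y}"]) (use assms in auto)

lemma interval_join: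
  assumes c: "c \<in> carrier L" and x: "x \<in> up_set L c" and y: "y \<in> up_set L c"
  shows "x \<squnion>\<^bsub>up_interval L c\<^esub> y = x \<squnion> y"
proof -
  interpret B: boolean_lattice "up_interval L c"
    using c by (rule interval_boolean)
  have xy: "x \<in> carrier L" "y \<in> carrier L" "c \<sqsubseteq> x" "c \<sqsubseteq> y"
    using x y by (auto simp: mem_up_set)
  have "c \<sqsubseteq> x \<squnion> y"
    using xy c le_trans[of c x "x \<squnion> y"] join_left by simp
  then have "is_lub (up_interval L c) (x \<squnion> y) {x, y}"
    using x y xy join_is_lub[of x y] by (simp add: is_lub_pair_iff mem_up_set)
  then show ?thesis
    using x y by (simp add: B.join_eqI)
qed

lemma interval_meet:
  assumes c: "c \<in> carrier L" and x: "x \<in> up_set L c" and y: "y \<in> up_set L c"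
  shows "x \<sqinter>\<^bsub>up_interval L c\<^esub> y = x \<sqinter> y"
proof -
  interpret B: boolean_lattice "up_interval L c"
    using c by (rule interval_boolean)
  have xy: "x \<in> carrier L" "y \<in> carrier L" "c \<sqsubseteq> x" "c \<sqsubseteq> y"
    using x y by (auto simp: mem_up_set)
  have "c \<sqsubseteq> x \<sqinter> y"
    using xy c by (simp add: meet_le)
  then have "is_glb (up_interval L c) (x \<sqinter> y) {x, y}"
    using x y xy meet_is_glb[of x y] by (simp add: is_glb_pair_iff mem_up_set)
  moreover have "is_glb (up_interval L c) (x \<sqinter>\<^bsub>up_interval L c\<^esub> y) {x, y}"
    by (rule B.meetI[where P = "\<lambda>s. is_glb (up_interval L c) s {x, y}"]) (use x y in auto)
  ultimately show ?thesis
    using B.greatest_unique by blast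
qed

text \<open>The three elements lie above a common \<open>c\<close>, and the interval above \<open>c\<close> is a Boolean algebra with
  the same binary joins and meets.\<close>

lemma distrib:
  assumes "x \<in> carrier L" "y \<in> carrier L" "z \<in> carrier L"
  shows "x \<sqinter> (y \<squnion> z) = (x \<sqinter> y) \<squnion> (x \<sqinter> z)"
proof -
  define c where "c = x \<sqinter> (y \<sqinter> z)"
  have yz: "y \<sqinter> z \<in> carrier L"
    using assms by simp
  have c: "c \<in> carrier L" "c \<sqsubseteq> x" "c \<sqsubseteq> y \<sqinter> z"
    using assms yz meet_left meet_right by (auto simp: c_def)
  then have "c \<sqsubseteq> y" "c \<sqsubseteq> z"
    using assms yz meet_left[of y z] meet_right[of y z] le_trans by blast+
  then have up: "x \<in> up_set L c" "y \<in> up_set L c" "z \<in> up_set L c"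
    using assms c by (auto simp: mem_up_set)
  interpret B: boolean_lattice "up_interval L c"
    using c(1) by (rule interval_boolean)
  have "y \<squnion> z \<in> up_set L c" "x \<sqinter> y \<in> up_set L c" "x \<sqinter> z \<in> up_set L c"
    using up B.join_closed[of y z] B.meet_closed[of x y] B.meet_closed[of x z] c(1)
    by (simp_all add: interval_join interval_meet)
  then show ?thesis
    using B.meet_join_distrib[of x y z] up c(1) by (simp add: interval_join interval_meet)
qed

definition lattice_filter :: "'a set \<Rightarrow> bool"
  where "lattice_filter U \<longleftrightarrow> U \<subseteq> carrier L \<and> (\<forall>x\<in>U. \<forall>y\<in>carrier L. x \<sqsubseteq> y \<longrightarrow> y \<in> U) \<and>
    (\<forall>x\<in>U. \<forall>y\<in>U. x \<sqinter> y \<in> U)"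

text \<open>The whole carrier counts as prime. It omits no element, so it lies in no set of the
  representation.\<close>

definition prime_filters :: "'a set set"
  where "prime_filters = {U. lattice_filter U \<and> \<top> \<in> U \<and>
    (\<forall>x\<in>carrier L. \<forall>y\<in>carrier L. x \<squnion> y \<in> U \<longrightarrow> x \<in> U \<or> y \<in> U)}"

text \<open>Taking the prime filters that omit \<open>a\<close>, not those that contain it, reverses the order, in
  accordance with the reverse inclusion on signed sets.\<close>

definition stone :: "'a \<Rightarrow> 'a set set"
  where "stone a = {U \<in> prime_filters. a \<notin> U}"

text \<open>The prime filter theorem. A filter that is maximal among those containing \<open>a\<close> and omitting \<open>b\<close> is
  prime: if it omits both \<open>x\<close> and \<open>y\<close>, then enlarging it by either one brings in \<open>b\<close>, and by
  distributivity so does \<open>x \<squnion> y\<close>.\<close>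

lemma prime_filter_separates:
  assumes a: "a \<in> carrier L" and b: "b \<in> carrier L" and ab: "\<not> a \<sqsubseteq> b"
  shows "\<exists>U\<in>prime_filters. a \<in> U \<and> b \<notin> U"
proof -
  define S where "S = {U. lattice_filter U \<and> a \<in> U \<and> b \<notin> U}"
  have "{x \<in> carrier L. a \<sqsubseteq> x} \<in> S"
    using a b ab by (auto simp: S_def lattice_filter_def meet_le intro: le_trans)
  moreover have "\<Union>C \<in> S" if "C \<noteq> {}" "subset.chain S C" for C
  proof -
    have CS: "\<And>U. U \<in> C \<Longrightarrow> lattice_filter U \<and> a \<in> U \<and> b \<notin> U"
      and lin: "\<And>U V. U \<in> C \<Longrightarrow> V \<in> C \<Longrightarrow> U \<subseteq> V \<or> V \<subseteq> U"
      using that(2) by (auto simp: S_def subset_chain_def)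
    have "lattice_filter (\<Union>C)"
      unfolding lattice_filter_def
    proof (intro conjI ballI impI)
      show "\<Union>C \<subseteq> carrier L"
        using CS unfolding lattice_filter_def by blast
      show "y \<in> \<Union>C" if "x \<in> \<Union>C" "y \<in> carrier L" "x \<sqsubseteq> y" for x y
        using that CS unfolding lattice_filter_def by blast
      show "x \<sqinter> y \<in> \<Union>C" if xy: "x \<in> \<Union>C" "y \<in> \<Union>C" for x y
      proof -
        from xy obtain U V where "U \<in> C" "V \<in> C" "x \<in> U" "y \<in> V"
          by blast
        then obtain W where "W \<in> C" "x \<in> W" "y \<in> W"
          using lin by blast
        then show ?thesis
          using CS unfolding lattice_filter_def by blast
      qed
    qed
    with that CS show ?thesis
      by (auto simp: S_def)
  qed
  ultimately obtain U where U: "U \<in> S" and max: "\<And>V. V \<in> S \<Longrightarrow> U \<subseteq> V \<Longrightarrow> V = U"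
    using subset_Zorn_nonempty[of S] by blast
  have fU: "lattice_filter U" and aU: "a \<in> U" and bU: "b \<notin> U"
    using U by (auto simp: S_def)
  have Uc: "U \<subseteq> carrier L"
    using fU by (simp add: lattice_filter_def)
  have up: "\<And>x y. x \<in> U \<Longrightarrow> y \<in> carrier L \<Longrightarrow> x \<sqsubseteq> y \<Longrightarrow> y \<in> U"
    and meetU: "\<And>x y. x \<in> U \<Longrightarrow> y \<in> U \<Longrightarrow> x \<sqinter> y \<in> U"
    using fU unfolding lattice_filter_def by blast+
  \<comment> \<open>By maximality, the filter generated by \<open>U\<close> and an element outside \<open>U\<close> contains \<open>b\<close>.\<close>
  have key: "\<exists>m\<in>U. m \<sqinter> x \<sqsubseteq> b" if x: "x \<in> carrier L" "x \<notin> U" for x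
  proof (rule ccontr)
    assume neg: "\<not> (\<exists>m\<in>U. m \<sqinter> x \<sqsubseteq> b)"
    define V where "V = {y \<in> carrier L. \<exists>m\<in>U. m \<sqinter> x \<sqsubseteq> y}"
    have inV: "y \<in> V" if "y \<in> carrier L" "m \<in> U" "m \<sqinter> x \<sqsubseteq> y" for y m
      using that by (auto simp: V_def)
    have UV: "U \<subseteq> V"
      using Uc x meet_left by (auto intro!: inV)
    have xV: "x \<in> V"
      using aU a x meet_right by (auto intro!: inV)
    have "lattice_filter V"
      unfolding lattice_filter_def
    proof (intro conjI ballI impI)
      show "V \<subseteq> carrier L"
        by (auto simp: V_def)
      show "z \<in> V" if "y \<in> V" "z \<in> carrier L" "y \<sqsubseteq> z" for y z
      proof -
        from that obtain m where m: "m \<in> U" "m \<sqinter> x \<sqsubseteq> y" "y \<in> carrier L"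
          by (auto simp: V_def)
        then have "m \<sqinter> x \<sqsubseteq> z"
          using that x Uc le_trans[of "m \<sqinter> x" y z] by auto
        then show ?thesis
          using that m inV by blast
      qed
      show "y \<sqinter> z \<in> V" if yz: "y \<in> V" "z \<in> V" for y z
      proof -
        from yz obtain m n where mn: "m \<in> U" "n \<in> U" "m \<sqinter> x \<sqsubseteq> y" "n \<sqinter> x \<sqsubseteq> z"
            "y \<in> carrier L" "z \<in> carrier L"
          by (auto simp: V_def)
        have mnc: "m \<in> carrier L" "n \<in> carrier L" "m \<sqinter> n \<in> carrier L"
          using mn Uc by (simp_all add: subset_iff)
        have "m \<sqinter> n \<sqinter> x \<sqsubseteq> m \<sqinter> x" "m \<sqinter> n \<sqinter> x \<sqsubseteq> n \<sqinter> x"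
          using mnc x meet_left[of "m \<sqinter> n" x] meet_right[of "m \<sqinter> n" x]
            meet_left[of m n] meet_right[of m n] le_trans[of "m \<sqinter> n \<sqinter> x" "m \<sqinter> n"]
          by (auto intro!: meet_le)
        then have "m \<sqinter> n \<sqinter> x \<sqsubseteq> y" "m \<sqinter> n \<sqinter> x \<sqsubseteq> z"
          using mn mnc x le_trans[of "m \<sqinter> n \<sqinter> x" "m \<sqinter> x" y] le_trans[of "m \<sqinter> n \<sqinter> x" "n \<sqinter> x" z]
          by auto
        then have "m \<sqinter> n \<sqinter> x \<sqsubseteq> y \<sqinter> z"
          using mn mnc x by (intro meet_le) auto
        then show ?thesis
          using mn meetU by (intro inV[where m = "m \<sqinter> n"]) auto
      qed
    qed
    moreover have "b \<notin> V"
      using neg by (auto simp: V_def)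
    ultimately have "V \<in> S"
      using UV aU by (auto simp: S_def)
    then show False
      using max UV xV x by blast
  qed
  have "x \<in> U \<or> y \<in> U" if xy: "x \<in> carrier L" "y \<in> carrier L" and j: "x \<squnion> y \<in> U" for x y
  proof (rule ccontr)
    assume neg: "\<not> (x \<in> U \<or> y \<in> U)"
    then obtain m n where mn: "m \<in> U" "n \<in> U" "m \<sqinter> x \<sqsubseteq> b" "n \<sqinter> y \<sqsubseteq> b"
      using key[of x] key[of y] xy by auto
    define k where "k = m \<sqinter> n"
    have c: "m \<in> carrier L" "n \<in> carrier L" "k \<in> U" "k \<in> carrier L"
      using mn Uc meetU by (auto simp: k_def)
    have k: "k \<sqsubseteq> m" "k \<sqsubseteq> n"
      using c meet_left meet_right by (auto simp: k_def)
    have "k \<sqinter> x \<sqsubseteq> m \<sqinter> x"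
      using c xy k meet_left[of k x] meet_right[of k x] le_trans[of "k \<sqinter> x" k m]
      by (intro meet_le) auto
    then have "k \<sqinter> x \<sqsubseteq> b"
      using mn c xy b le_trans[of "k \<sqinter> x" "m \<sqinter> x" b] by simp
    moreover have "k \<sqinter> y \<sqsubseteq> n \<sqinter> y"
      using c xy k meet_left[of k y] meet_right[of k y] le_trans[of "k \<sqinter> y" k n]
      by (intro meet_le) auto
    then have "k \<sqinter> y \<sqsubseteq> b"
      using mn c xy b le_trans[of "k \<sqinter> y" "n \<sqinter> y" b] by simp
    ultimately have "k \<sqinter> (x \<squnion> y) \<sqsubseteq> b"
      using c xy b by (simp add: distrib join_le)
    moreover have "k \<sqinter> (x \<squnion> y) \<in> U"
      using c j meetU by blast
    ultimately show False
      using up b bU by blast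
  qed
  moreover have "\<top> \<in> U"
    using up[OF aU] a by simp
  ultimately show ?thesis
    using fU aU bU by (auto simp: prime_filters_def)
qed

lemma stone_subset_iff:
  assumes "a \<in> carrier L" "b \<in> carrier L"
  shows "stone b \<subseteq> stone a \<longleftrightarrow> a \<sqsubseteq> b"
proof
  show "stone b \<subseteq> stone a" if "a \<sqsubseteq> b"
    using that assms by (auto simp: stone_def prime_filters_def lattice_filter_def)
  show "a \<sqsubseteq> b" if "stone b \<subseteq> stone a"
    using that prime_filter_separates[OF assms] by (auto simp: stone_def)
qed

lemma stone_eq_iff:
  assumes "a \<in> carrier L" "b \<in> carrier L"
  shows "stone a = stone b \<longleftrightarrow> a = b"
  using assms stone_subset_iff le_antisym by (metis subset_refl)

lemma stone_top: "stone \<top> = {}"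
  by (auto simp: stone_def prime_filters_def)

lemma stone_join:
  assumes "a \<in> carrier L" "b \<in> carrier L"
  shows "stone (a \<squnion> b) = stone a \<inter> stone b"
proof
  show "stone (a \<squnion> b) \<subseteq> stone a \<inter> stone b"
    using assms stone_subset_iff join_left join_right by (metis join_closed le_inf_iff)
  show "stone a \<inter> stone b \<subseteq> stone (a \<squnion> b)"
    using assms by (auto simp: stone_def prime_filters_def)
qed

lemma stone_meet:
  assumes "a \<in> carrier L" "b \<in> carrier L"
  shows "stone (a \<sqinter> b) = stone a \<union> stone b"
proof
  show "stone a \<union> stone b \<subseteq> stone (a \<sqinter> b)"
    using assms stone_subset_iff meet_left meet_right by (metis meet_closed le_sup_iff)
  show "stone (a \<sqinter> b) \<subseteq> stone a \<union> stone b"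
    using assms by (auto simp: stone_def prime_filters_def lattice_filter_def)
qed

text \<open>Under \<open>stone\<close> the equations that define the complement of \<open>a \<squnion> b\<close> above \<open>b\<close> have exactly one solution,
  the set difference. This yields the uniqueness needed to evaluate the definite description, so
  that relative complements in Boolean lattices need no separate treatment.\<close>

lemma impl_closed_stone:
  assumes a: "a \<in> carrier L" and b: "b \<in> carrier L"
  shows "impl L a b \<in> carrier L \<and> stone (impl L a b) = stone b - stone a"
proof -
  interpret B: boolean_lattice "up_interval L b"
    using b by (rule interval_boolean)
  let ?j = "a \<squnion> b"
  have j: "?j \<in> up_set L b"
    using a b join_right by (simp add: mem_up_set)
  have tb: "\<top> \<in> up_set L b" "b \<in> up_set L b"
    using b by (simp_all add: mem_up_set)
  have top: "\<top>\<^bsub>up_interval L b\<^esub> = \<top>"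
    using tb B.top_higher[of \<top>] B.top_closed le_antisym[of "\<top>\<^bsub>up_interval L b\<^esub>" \<top>]
    by (simp add: mem_up_set)
  have bot: "\<bottom>\<^bsub>up_interval L b\<^esub> = b"
    using tb B.bottom_lower[of b] B.bottom_closed le_antisym[of "\<bottom>\<^bsub>up_interval L b\<^esub>" b] b
    by (simp add: mem_up_set)
  have char: "y \<in> up_set L b \<and> ?j \<squnion>\<^bsub>up_interval L b\<^esub> y = \<top> \<and> ?j \<sqinter>\<^bsub>up_interval L b\<^esub> y = b \<longleftrightarrow>
      y \<in> carrier L \<and> stone y = stone b - stone a" (is "?C y \<longleftrightarrow> ?S y") for y
  proof (cases "y \<in> up_set L b")
    case True
    then have y: "y \<in> carrier L"
      by (simp add: mem_up_set)
    have "?C y \<longleftrightarrow> stone (?j \<squnion> y) = stone \<top> \<and> stone (?j \<sqinter> y) = stone b"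
      using True y j a b by (simp add: interval_join interval_meet stone_eq_iff)
    also have "\<dots> \<longleftrightarrow> stone y = stone b - stone a"
      using y a b by (auto simp: stone_join stone_meet stone_top)
    finally show ?thesis
      using y by simp
  next
    case False
    then show ?thesis
      using b by (auto simp: mem_up_set simp flip: stone_subset_iff)
  qed
  have "\<exists>y\<in>up_set L b. ?j \<squnion>\<^bsub>up_interval L b\<^esub> y = \<top> \<and> ?j \<sqinter>\<^bsub>up_interval L b\<^esub> y = b"
    using B.complement_exists[of ?j] j by (simp add: top bot)
  then obtain y where y: "?S y"
    unfolding Bex_def char ..
  have "impl L a b = (THE y. ?S y)"
    by (simp add: impl_def complement_def top bot char)
  also have "\<dots> = y"
    using y by (intro the_equality) (auto simp flip: stone_eq_iff)
  finally show ?thesis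
    using y by simp
qed

lemma ring_of_sets_stone: "ring_of_sets UNIV (stone ` carrier L)"
proof (rule ring_of_setsI)
  show "{} \<in> stone ` carrier L"
    using stone_top top_closed by (metis imageI)
  fix A B assume "A \<in> stone ` carrier L" "B \<in> stone ` carrier L"
  then obtain a b where ab: "a \<in> carrier L" "b \<in> carrier L" "A = stone a" "B = stone b"
    by auto
  then show "A \<union> B \<in> stone ` carrier L"
    using stone_meet meet_closed by (metis imageI)
  show "A - B \<in> stone ` carrier L"
    using impl_closed_stone[of b a] ab by (metis imageI)
qed simp

definition signed_stone :: "'a \<times> 'a \<Rightarrow> ('a set \<times> bool) set"
  where "signed_stone = (\<lambda>(a, b). stone a \<times> {True} \<union> stone b \<times> {False})"

lemma slice_signed_stone: "slice (signed_stone (a, b)) c = (if c then stone a else stone b)"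
  by (auto simp: signed_stone_def)

text \<open>A pair with \<open>a \<squnion> b = \<top>\<close> becomes a pair of disjoint sets, that is, a consistent signed set.\<close>

lemma cubic_order_iso_signed_stone:
  "cubic_order_iso (pair_algebra L) (signed_algebra (stone ` carrier L)) signed_stone"
proof -
  have carrier_iff: "(a, b) \<in> carrier (pair_algebra L) \<longleftrightarrow>
      a \<in> carrier L \<and> b \<in> carrier L \<and> stone a \<inter> stone b = {}" for a b
  proof -
    have "a \<squnion> b = \<top> \<longleftrightarrow> stone a \<inter> stone b = {}" if "a \<in> carrier L" "b \<in> carrier L"
      using that by (simp flip: stone_eq_iff add: stone_join stone_top)
    then show ?thesis
      using meet_is_glb[of a b] by (auto simp: pair_algebra_def)
  qed
  have le: "(a, b) \<sqsubseteq>\<^bsub>pair_algebra L\<^esub> (c, d) \<longleftrightarrow> a \<sqsubseteq> c \<and> b \<sqsubseteq> d" for a b c d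
    by (simp add: pair_algebra_def)
  have Delta: "\<Delta>\<^bsub>pair_algebra L\<^esub> (a, b) (c, d) = (a \<sqinter> impl L b d, b \<sqinter> impl L a c)" for a b c d
    by (simp add: pair_algebra_def)
  have bij: "bij_betw signed_stone (carrier (pair_algebra L)) (signed_sets (stone ` carrier L))"
    unfolding bij_betw_def
  proof (intro conjI inj_onI subset_antisym subsetI)
    fix x y assume xy: "x \<in> carrier (pair_algebra L)" "y \<in> carrier (pair_algebra L)"
      "signed_stone x = signed_stone y"
    obtain a b c d where ab: "x = (a, b)" "y = (c, d)"
      by (cases x, cases y) auto
    have "slice (signed_stone (a, b)) s = slice (signed_stone (c, d)) s" for s
      using xy by (simp add: ab)
    from this[of True] this[of False] show "x = y"
      using xy by (simp add: ab carrier_iff slice_signed_stone stone_eq_iff)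
  next
    fix Z assume "Z \<in> signed_stone ` carrier (pair_algebra L)"
    then obtain a b where "(a, b) \<in> carrier (pair_algebra L)" "Z = signed_stone (a, b)"
      by (metis imageE surj_pair)
    moreover from this have "consistent Z"
      by (auto simp: carrier_iff signed_stone_def consistent_def)
    ultimately show "Z \<in> signed_sets (stone ` carrier L)"
      by (simp add: signed_sets_def slice_signed_stone carrier_iff)
  next
    fix Z assume Z: "Z \<in> signed_sets (stone ` carrier L)"
    then have "slice Z True \<in> stone ` carrier L" "slice Z False \<in> stone ` carrier L"
      by (simp_all add: signed_sets_def)
    then obtain a b where ab: "a \<in> carrier L" "slice Z True = stone a"
        "b \<in> carrier L" "slice Z False = stone b"
      by auto
    have "Z = signed_stone (a, b)"
    proof (rule slice_eqI)
      show "slice Z c = slice (signed_stone (a, b)) c" for c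
        using ab by (cases c) (simp_all add: slice_signed_stone)
    qed
    moreover have "stone a \<inter> stone b = {}"
      using signed_setsD[OF Z, of _ True] by (auto simp flip: ab(2,4))
    ultimately show "Z \<in> signed_stone ` carrier (pair_algebra L)"
      using ab by (auto simp: carrier_iff)
  qed
  show ?thesis
  proof (unfold_locales, simp_all only: signed_algebra_simps)
    show "bij_betw signed_stone (carrier (pair_algebra L)) (signed_sets (stone ` carrier L))"
      by (rule bij)
    fix x y assume xy: "x \<in> carrier (pair_algebra L)" "y \<in> carrier (pair_algebra L)"
    obtain a b c d where ab: "x = (a, b)" "y = (c, d)"
      by (cases x, cases y) auto
    have c: "a \<in> carrier L" "b \<in> carrier L" "c \<in> carrier L" "d \<in> carrier L"
        "stone a \<inter> stone b = {}" "stone c \<inter> stone d = {}"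
      using xy by (auto simp: ab carrier_iff)
    show iff: "signed_stone y \<subseteq> signed_stone x \<longleftrightarrow> x \<sqsubseteq>\<^bsub>pair_algebra L\<^esub> y"
      using c by (auto simp: ab le signed_stone_def simp flip: stone_subset_iff)
    assume "x \<sqsubseteq>\<^bsub>pair_algebra L\<^esub> y"
    then have sub: "stone c \<subseteq> stone a" "stone d \<subseteq> stone b"
      using c by (auto simp: ab le stone_subset_iff)
    have i: "impl L c a \<in> carrier L" "impl L d b \<in> carrier L"
      "stone (impl L c a) = stone a - stone c" "stone (impl L d b) = stone b - stone d"
      using c impl_closed_stone by auto
    show "\<Delta>\<^bsub>pair_algebra L\<^esub> y x \<in> carrier (pair_algebra L)"
      using c i sub by (auto simp: ab Delta carrier_iff stone_meet)
    show "signed_stone (\<Delta>\<^bsub>pair_algebra L\<^esub> y x) =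
        signed_stone y \<union> flip (signed_stone x - signed_stone y)"
      using c i sub by (auto simp: ab Delta stone_meet signed_stone_def)
  qed
qed

end

section \<open>Filters given by local signed sets\<close>

text \<open>In terms of the Stone space whose compact open sets form \<open>R\<close>, these are the clopen sets. They form
  an algebra of sets even when \<open>R\<close> has no largest member.\<close>

definition local_sets :: "'p set set \<Rightarrow> 'p set set"
  where "local_sets R = {U. U \<subseteq> \<Union>R \<and> (\<forall>A\<in>R. U \<inter> A \<in> R)}"

lemma (in ring_of_sets) ring_of_sets_local: "ring_of_sets (\<Union>M) (local_sets M)"
proof (rule ring_of_setsI)
  fix U V assume UV: "U \<in> local_sets M" "V \<in> local_sets M"
  have "(U \<union> V) \<inter> A \<in> M" "(U - V) \<inter> A \<in> M" if "A \<in> M" for A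
  proof -
    have "(U \<union> V) \<inter> A = (U \<inter> A) \<union> (V \<inter> A)" "(U - V) \<inter> A = (U \<inter> A) - (V \<inter> A)"
      by auto
    then show "(U \<union> V) \<inter> A \<in> M" "(U - V) \<inter> A \<in> M"
      using UV that by (auto simp: local_sets_def)
  qed
  then show "U \<union> V \<in> local_sets M" "U - V \<in> local_sets M"
    using UV by (auto simp: local_sets_def)
qed (auto simp: local_sets_def)

lemma (in ring_of_sets) local_sets_superset: "M \<subseteq> local_sets M"
  by (auto simp: local_sets_def)

lemma (in ring_of_sets) Union_local: "\<Union>M \<in> local_sets M"
proof -
  have "\<Union>M \<inter> A = A" if "A \<in> M" for A
    using that by auto
  then show ?thesis
    by (simp add: local_sets_def)
qed

lemma signed_sets_mono: "R \<subseteq> R' \<Longrightarrow> signed_sets R \<subseteq> signed_sets R'"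
  by (auto simp: signed_sets_def)

locale signed_representation =
  ring_of_sets \<Omega> R + cubic_algebra L + iso: cubic_order_iso L "signed_algebra R" \<phi>
  for \<Omega> :: "'p set" and R and L :: "'a cubic" (structure) and \<phi>
begin

sublocale loc: ring_of_sets "\<Union>R" "local_sets R"
  by (rule ring_of_sets_local)

abbreviation local_signed :: "('p \<times> bool) set set"
  where "local_signed \<equiv> signed_sets (local_sets R)"

text \<open>The shape of all Boolean filters, when \<open>Z\<close> is local; for \<open>Z = \<phi> g\<close> it is the principal filter of \<open>g\<close>.\<close>

definition filter_of :: "('p \<times> bool) set \<Rightarrow> 'a set"
  where "filter_of Z = {x \<in> carrier L. \<phi> x \<subseteq> Z}"

text \<open>Every point of the space receives a sign. These will be the signed sets of g-filters.\<close>

definition spanning :: "('p \<times> bool) set \<Rightarrow> bool"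
  where "spanning Z \<longleftrightarrow> (\<forall>p\<in>\<Union>R. \<forall>b. (p, b) \<in> Z \<or> (p, \<not> b) \<in> Z)"

lemma phi_signed: "x \<in> carrier L \<Longrightarrow> \<phi> x \<in> signed_sets R"
  using iso.e_in by simp

lemma phi_local: "x \<in> carrier L \<Longrightarrow> \<phi> x \<in> local_signed"
  using phi_signed signed_sets_mono[OF local_sets_superset] by blast

lemma phi_surj:
  assumes "Z \<in> signed_sets R"
  obtains x where "x \<in> carrier L" "\<phi> x = Z"
  using assms iso.carrier_image by (auto simp: image_iff)

lemma le_iff_phi: "\<lbrakk>x \<in> carrier L; y \<in> carrier L\<rbrakk> \<Longrightarrow> x \<sqsubseteq> y \<longleftrightarrow> \<phi> y \<subseteq> \<phi> x"
  using iso.le_iff by simp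

lemma phi_eqD: "\<lbrakk>\<phi> x = \<phi> y; x \<in> carrier L; y \<in> carrier L\<rbrakk> \<Longrightarrow> x = y"
  using iso.e_eq_iff by simp

lemma phi_join:
  assumes "x \<in> carrier L" "y \<in> carrier L"
  shows "\<phi> (x \<squnion> y) = \<phi> x \<inter> \<phi> y"
proof -
  have "upper_semilattice L" ..
  then have "\<phi> (x \<squnion> y) = \<phi> x \<squnion>\<^bsub>signed_algebra R\<^esub> \<phi> y"
    by (rule iso.join_hom) (use assms in simp_all)
  then show ?thesis
    using assms phi_signed by (simp add: signed_join)
qed

lemma phi_top_iff: "x \<in> carrier L \<Longrightarrow> \<phi> x = {} \<longleftrightarrow> x = \<top>"
proof -
  obtain t where t: "t \<in> carrier L" "\<phi> t = {}"
    using phi_surj empty_signed by blast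
  then have "\<top> \<sqsubseteq> t"
    by (simp add: le_iff_phi)
  then have "\<top> = t"
    using t top_higher[of t] le_antisym[of "\<top>" t] by simp
  then show "\<phi> x = {} \<longleftrightarrow> x = \<top>" if "x \<in> carrier L"
    using t that phi_eqD[of x t] by auto
qed

lemma phi_Delta:
  assumes "x \<in> carrier L" "y \<in> carrier L" "x \<sqsubseteq> y"
  shows "\<phi> (\<Delta> y x) = \<phi> y \<union> flip (\<phi> x - \<phi> y)"
  using iso.Delta_hom[OF assms] by simp

lemma phi_glb_iff:
  assumes "x \<in> carrier L" "y \<in> carrier L"
  shows "is_glb L m {x, y} \<longleftrightarrow> m \<in> carrier L \<and> \<phi> m = \<phi> x \<union> \<phi> y"
proof (cases "m \<in> carrier L")
  case True
  then have "is_glb L m {x, y} \<longleftrightarrow> is_glb (signed_algebra R) (\<phi> m) {\<phi> x, \<phi> y}"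
    using iso.is_glb_iff[of m x y] assms by simp
  then show ?thesis
    using True assms by (simp add: signed_is_glb_iff phi_signed)
next
  case False
  then show ?thesis
    using greatest_closed by blast
qed

lemma local_signed_support:
  assumes "Z \<in> local_signed" "(p, b) \<in> Z"
  shows "p \<in> \<Union>R"
proof -
  have "slice Z b \<subseteq> \<Union>R"
    using assms(1) by (simp add: signed_sets_def local_sets_def)
  then show ?thesis
    using assms(2) by auto
qed

lemma Int_local_signed:
  assumes "Y \<in> signed_sets R" "Z \<in> local_signed"
  shows "Y \<inter> Z \<in> signed_sets R"
proof -
  have "slice (Y \<inter> Z) b \<in> R" for b
    using assms by (auto simp: signed_sets_def slice_set_ops local_sets_def Int_commute)
  then show ?thesis
    using assms by (simp add: signed_sets_def consistent_Int)
qed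

text \<open>A local signed set is the union of the signed sets over \<open>R\<close> contained in it, so it is recovered
  from its filter. This gives injectivity of \<open>filter_of\<close>, and it reduces conditions on all elements of a
  filter to one condition on the signed set.\<close>

lemma Union_phi_filter_of:
  assumes Z: "Z \<in> local_signed"
  shows "(\<Union>x\<in>filter_of Z. \<phi> x) = Z"
proof
  show "(\<Union>x\<in>filter_of Z. \<phi> x) \<subseteq> Z"
    by (auto simp: filter_of_def)
  show "Z \<subseteq> (\<Union>x\<in>filter_of Z. \<phi> x)"
  proof
    fix q assume q: "q \<in> Z"
    obtain p b where pb: "q = (p, b)"
      by (cases q)
    have "p \<in> \<Union>R"
      using local_signed_support Z q unfolding pb by blast
    then obtain A where A: "A \<in> R" "p \<in> A"
      by blast
    obtain x where x: "x \<in> carrier L" "\<phi> x = A \<times> {b} \<inter> Z"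
      using phi_surj Int_local_signed[OF times_signed[OF A(1)] Z] by blast
    then have "x \<in> filter_of Z" "q \<in> \<phi> x"
      using q A pb by (auto simp: filter_of_def)
    then show "q \<in> (\<Union>x\<in>filter_of Z. \<phi> x)"
      by blast
  qed
qed

lemma filter_of_subset_iff:
  assumes "Y \<in> local_signed"
  shows "filter_of Y \<subseteq> filter_of Z \<longleftrightarrow> Y \<subseteq> Z"
proof
  assume "filter_of Y \<subseteq> filter_of Z"
  then have "(\<Union>x\<in>filter_of Y. \<phi> x) \<subseteq> Z"
    by (auto simp: filter_of_def)
  then show "Y \<subseteq> Z"
    using Union_phi_filter_of[OF assms] by simp
qed (auto simp: filter_of_def)

lemma filter_of_eqD:
  "\<lbrakk>filter_of Y = filter_of Z; Y \<in> local_signed; Z \<in> local_signed\<rbrakk> \<Longrightarrow> Y = Z"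
  using filter_of_subset_iff by blast

lemma top_in_filter_of: "\<top> \<in> filter_of Z"
  using phi_top_iff[of \<top>] by (simp add: filter_of_def)

lemma cubic_filter_filter_of:
  assumes Z: "Z \<in> local_signed"
  shows "cubic_filter L (filter_of Z)"
  unfolding cubic_filter_def
proof (intro conjI ballI impI)
  show "filter_of Z \<subseteq> carrier L"
    by (auto simp: filter_of_def)
  show "filter_of Z \<noteq> {}"
    using top_in_filter_of by blast
  show "y \<in> filter_of Z" if "x \<in> filter_of Z" "y \<in> carrier L" "x \<sqsubseteq> y" for x y
    using that by (auto simp: filter_of_def le_iff_phi)
  show "\<exists>m\<in>filter_of Z. is_glb L m {x, y}" if xy: "x \<in> filter_of Z" "y \<in> filter_of Z" for x y
  proof -
    have c: "x \<in> carrier L" "y \<in> carrier L" "\<phi> x \<union> \<phi> y \<subseteq> Z"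
      using xy by (auto simp: filter_of_def)
    then have "\<phi> x \<union> \<phi> y \<in> signed_sets R"
      using Un_signed phi_signed consistent_subset signed_consistent[OF Z] by blast
    then obtain m where "m \<in> carrier L" "\<phi> m = \<phi> x \<union> \<phi> y"
      using phi_surj by blast
    then show ?thesis
      using c phi_glb_iff[of x y m] by (auto simp: filter_of_def)
  qed
qed

lemma filter_imp_filter_of:
  assumes Z: "Z \<in> local_signed"
  shows "filter_imp L (filter_of Z) (filter_of W) = filter_of (W - Z)"
proof -
  have "(\<forall>g\<in>filter_of Z. h \<squnion> g = \<top>) \<longleftrightarrow> \<phi> h \<inter> Z = {}" if h: "h \<in> carrier L" for h
  proof -
    have "h \<squnion> g = \<top> \<longleftrightarrow> \<phi> h \<inter> \<phi> g = {}" if "g \<in> filter_of Z" for g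
      using h that phi_top_iff[of "h \<squnion> g"] by (simp add: filter_of_def phi_join)
    then have "(\<forall>g\<in>filter_of Z. h \<squnion> g = \<top>) \<longleftrightarrow> \<phi> h \<inter> (\<Union>g\<in>filter_of Z. \<phi> g) = {}"
      by blast
    then show ?thesis
      by (simp add: Union_phi_filter_of[OF Z])
  qed
  then show ?thesis
    by (auto simp: filter_imp_def filter_of_def)
qed

text \<open>An element below \<open>Y \<union> Z\<close> is the meet of its parts in \<open>Y\<close> and in \<open>Z\<close>; these are elements of the
  algebra because local sets cut members of \<open>R\<close> in members of \<open>R\<close>.\<close>

lemma filter_join_filter_of:
  assumes Y: "Y \<in> local_signed" and Z: "Z \<in> local_signed"
  shows "filter_join L (filter_of Y) (filter_of Z) = filter_of (Y \<union> Z)"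
proof
  show "filter_join L (filter_of Y) (filter_of Z) \<subseteq> filter_of (Y \<union> Z)"
    by (auto simp: filter_join_def filter_of_def phi_glb_iff)
  show "filter_of (Y \<union> Z) \<subseteq> filter_join L (filter_of Y) (filter_of Z)"
  proof
    fix m assume "m \<in> filter_of (Y \<union> Z)"
    then have m: "m \<in> carrier L" "\<phi> m \<subseteq> Y \<union> Z"
      by (auto simp: filter_of_def)
    obtain y where y: "y \<in> carrier L" "\<phi> y = \<phi> m \<inter> Y"
      using phi_surj Int_local_signed[OF phi_signed[OF m(1)] Y] by blast
    obtain z where z: "z \<in> carrier L" "\<phi> z = \<phi> m \<inter> Z"
      using phi_surj Int_local_signed[OF phi_signed[OF m(1)] Z] by blast
    have "is_glb L m {y, z}" "y \<in> filter_of Y" "z \<in> filter_of Z"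
      using m y z by (auto simp: phi_glb_iff filter_of_def)
    then show "m \<in> filter_join L (filter_of Y) (filter_of Z)"
      by (auto simp: filter_join_def)
  qed
qed

lemma Delta_top_filter_of: "\<Delta> \<top> ` filter_of Z = filter_of (flip Z)"
proof -
  have D: "\<Delta> \<top> x \<in> carrier L" "\<phi> (\<Delta> \<top> x) = flip (\<phi> x)" if "x \<in> carrier L" for x
    using that phi_top_iff[of \<top>] by (simp_all add: Delta_closed phi_Delta)
  show ?thesis
  proof (intro subset_antisym subsetI)
    fix y assume "y \<in> \<Delta> \<top> ` filter_of Z"
    then show "y \<in> filter_of (flip Z)"
      by (auto simp: filter_of_def D)
  next
    fix y assume y: "y \<in> filter_of (flip Z)"
    then have "\<phi> (\<Delta> \<top> y) \<subseteq> Z" "y \<in> carrier L"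
      by (auto simp: filter_of_def D)
    moreover from this have "y = \<Delta> \<top> (\<Delta> \<top> y)"
      by (simp add: Delta_involution)
    ultimately show "y \<in> \<Delta> \<top> ` filter_of Z"
      using D by (auto simp: filter_of_def)
  qed
qed

lemma filter_Delta_filter_of:
  assumes "Y \<in> local_signed" "Z \<in> local_signed"
  shows "filter_Delta L (filter_of Y) (filter_of Z) = filter_of (Y \<union> flip (Z - Y))"
  using assms
  by (simp add: filter_Delta_def filter_imp_filter_of Delta_top_filter_of filter_join_filter_of
      loc.flip_signed loc.Diff_signed Un_commute)

text \<open>The relative complement of \<open>filter_of Y\<close> is given by \<open>Z - Y\<close>, and \<open>Y \<union> (Z - Y) = Z\<close>.\<close>

lemma relatively_boolean_filter_of:
  assumes "Y \<in> local_signed" "Z \<in> local_signed" "Y \<subseteq> Z"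
  shows "relatively_boolean L (filter_of Z) (filter_of Y)"
proof -
  have "Y \<union> (Z - Y) = Z"
    using assms by auto
  then show ?thesis
    using assms
    by (simp add: relatively_boolean_def filter_of_subset_iff filter_imp_filter_of
        filter_join_filter_of loc.Diff_signed)
qed

section \<open>Generating filters\<close>

text \<open>Reflecting the part of \<open>\<phi> x\<close> outside \<open>Z\<close> moves it into \<open>Z\<close>, because every point has a sign in \<open>Z\<close>.
  Hence \<open>x\<close> is itself a reflection \<open>\<Delta> z y\<close> of two elements of the filter.\<close>

lemma g_filter_filter_of:
  assumes Z: "Z \<in> local_signed" and "spanning Z"
  shows "g_filter L (filter_of Z)"
proof -
  have "x \<in> T" if T: "cubic_subalgebra L T" "filter_of Z \<subseteq> T" and x: "x \<in> carrier L" for x T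
  proof -
    have "(\<phi> x \<inter> Z) \<union> flip (\<phi> x - Z) \<subseteq> Z"
    proof
      fix q assume q: "q \<in> (\<phi> x \<inter> Z) \<union> flip (\<phi> x - Z)"
      obtain p b where pb: "q = (p, b)"
        by (cases q)
      have "p \<in> \<Union>R" if "(p, \<not> b) \<in> \<phi> x"
        using phi_local[OF x] that by (rule local_signed_support)
      then show "q \<in> Z"
        using q pb \<open>spanning Z\<close> unfolding spanning_def by auto
    qed
    moreover have "(\<phi> x \<inter> Z) \<union> flip (\<phi> x - Z) \<in> signed_sets R"
      using Delta_signed[OF phi_signed[OF x] Int_local_signed[OF phi_signed[OF x] Z]]
      by (simp add: Diff_Int)
    ultimately obtain y where y: "y \<in> carrier L" "\<phi> y = (\<phi> x \<inter> Z) \<union> flip (\<phi> x - Z)"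
        "y \<in> filter_of Z"
      using phi_surj by (auto simp: filter_of_def)
    obtain z where z: "z \<in> carrier L" "\<phi> z = \<phi> x \<inter> Z"
      using phi_surj Int_local_signed[OF phi_signed[OF x] Z] by blast
    have yz: "y \<sqsubseteq> z" "z \<in> filter_of Z"
      using y z by (auto simp: le_iff_phi filter_of_def)
    have "\<phi> (\<Delta> z y) = (\<phi> x \<inter> Z) \<union> flip (flip (\<phi> x - Z) - \<phi> x \<inter> Z)"
      using y z yz by (simp add: phi_Delta Un_Diff)
    also have "flip (\<phi> x - Z) - \<phi> x \<inter> Z = flip (\<phi> x - Z)"
      using signed_setsD[OF phi_signed[OF x]] by auto
    finally have "\<phi> (\<Delta> z y) = \<phi> x"
      by auto
    then have "\<Delta> z y = x"
      using x y z yz by (intro phi_eqD) (auto intro: Delta_closed)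
    moreover have "y \<in> T" "z \<in> T"
      using T(2) y yz by auto
    then have "\<Delta> z y \<in> T"
      using T(1) yz unfolding cubic_subalgebra_def by blast
    ultimately show ?thesis
      by simp
  qed
  moreover have "cubic_subalgebra L (carrier L)"
    by (auto simp: cubic_subalgebra_def Delta_closed)
  then have "generated_subalgebra L (filter_of Z) \<subseteq> carrier L"
    by (auto simp: generated_subalgebra_def filter_of_def)
  ultimately have "generated_subalgebra L (filter_of Z) = carrier L"
    by (auto simp: generated_subalgebra_def)
  then show ?thesis
    using cubic_filter_filter_of[OF Z] by (simp add: g_filter_def)
qed

text \<open>The elements whose points all occur, with either sign, in a single member of \<open>F\<close> form a subalgebra
  containing \<open>F\<close>, hence everything. So over any set \<open>A\<close> of \<open>R\<close> a single \<open>z\<close> in \<open>F\<close> already decides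
  all signs, and there the union \<open>Z\<close> of \<open>F\<close> agrees with \<open>\<phi> z\<close>. This makes \<open>Z\<close> local and spanning, and
  puts every element below \<open>Z\<close> into \<open>F\<close>.\<close>

lemma g_filter_obtain_spanning:
  assumes F: "g_filter L F"
  obtains Z where "Z \<in> local_signed" "spanning Z" "F = filter_of Z"
proof -
  have Fc: "F \<subseteq> carrier L" and up: "\<And>x y. x \<in> F \<Longrightarrow> y \<in> carrier L \<Longrightarrow> x \<sqsubseteq> y \<Longrightarrow> y \<in> F"
    and dir: "\<And>x y. x \<in> F \<Longrightarrow> y \<in> F \<Longrightarrow> \<exists>m\<in>F. is_glb L m {x, y}" and ne: "F \<noteq> {}"
    and gen: "generated_subalgebra L F = carrier L"
    using F by (auto simp: g_filter_def cubic_filter_def)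
  define T where "T = {x \<in> carrier L. \<exists>z\<in>F. \<phi> x \<subseteq> \<phi> z \<union> flip (\<phi> z)}"
  have "cubic_subalgebra L T"
    unfolding cubic_subalgebra_def
  proof (intro conjI ballI impI)
    show "T \<subseteq> carrier L"
      by (auto simp: T_def)
    show "\<top> \<in> T"
      using ne phi_top_iff[of \<top>] by (auto simp: T_def)
    show "x \<squnion> y \<in> T" if "x \<in> T" "y \<in> T" for x y
      using that by (auto simp: T_def phi_join)
    show "\<Delta> y x \<in> T" if xy: "x \<in> T" "y \<in> T" "x \<sqsubseteq> y" for x y
    proof -
      from xy obtain z where z: "z \<in> F" "\<phi> x \<subseteq> \<phi> z \<union> flip (\<phi> z)"
        by (auto simp: T_def)
      have c: "x \<in> carrier L" "y \<in> carrier L" "\<phi> y \<subseteq> \<phi> x"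
        using xy le_iff_phi by (auto simp: T_def)
      have "\<phi> (\<Delta> y x) \<subseteq> \<phi> x \<union> flip (\<phi> x)"
        using c xy by (auto simp: phi_Delta)
      also have "\<dots> \<subseteq> \<phi> z \<union> flip (\<phi> z)"
        using z(2) by auto
      finally show ?thesis
        using z(1) c xy by (auto simp: T_def Delta_closed)
    qed
  qed
  moreover have "F \<subseteq> T"
    using Fc by (auto simp: T_def)
  ultimately have cover: "\<exists>z\<in>F. \<phi> x \<subseteq> \<phi> z \<union> flip (\<phi> z)" if "x \<in> carrier L" for x
    using that gen by (auto simp: generated_subalgebra_def T_def)
  define Z where "Z = (\<Union>x\<in>F. \<phi> x)"
  have cons: "consistent Z"
    unfolding consistent_def
  proof (intro allI impI notI)
    fix p b assume "(p, b) \<in> Z" "(p, \<not> b) \<in> Z"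
    then obtain x y where xy: "x \<in> F" "y \<in> F" "(p, b) \<in> \<phi> x" "(p, \<not> b) \<in> \<phi> y"
      by (auto simp: Z_def)
    then obtain m where "m \<in> F" "is_glb L m {x, y}"
      using dir by blast
    then have "m \<in> carrier L" "\<phi> m = \<phi> x \<union> \<phi> y"
      using xy Fc phi_glb_iff[of x y m] by auto
    then show False
      using xy signed_setsD[OF phi_signed, of m p b] by auto
  qed
  \<comment> \<open>Where \<open>\<phi> z\<close> gives a sign, \<open>Z\<close> can give no other.\<close>
  have trace: "Y \<inter> Z = Y \<inter> \<phi> z" if "z \<in> F" "Y \<subseteq> \<phi> z \<union> flip (\<phi> z)" for Y z
  proof
    show "Y \<inter> \<phi> z \<subseteq> Y \<inter> Z"
      using that by (auto simp: Z_def)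
    show "Y \<inter> Z \<subseteq> Y \<inter> \<phi> z"
    proof
      fix q assume q: "q \<in> Y \<inter> Z"
      obtain p b where pb: "q = (p, b)"
        by (cases q)
      have "(p, \<not> b) \<notin> Z"
        using q cons by (auto simp: pb consistent_def)
      then have "(p, \<not> b) \<notin> \<phi> z"
        using that by (auto simp: Z_def)
      then show "q \<in> Y \<inter> \<phi> z"
        using q that by (auto simp: pb)
    qed
  qed
  have covA: "\<exists>z\<in>F. A \<times> {b} \<subseteq> \<phi> z \<union> flip (\<phi> z)" if "A \<in> R" for A b
  proof -
    obtain x where "x \<in> carrier L" "\<phi> x = A \<times> {b}"
      using phi_surj[OF times_signed[OF \<open>A \<in> R\<close>]] .
    then show ?thesis
      using cover[of x] by simp
  qed
  have "slice Z b \<in> local_sets R" for b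
  proof -
    have "slice Z b \<inter> A \<in> R" if A: "A \<in> R" for A
    proof -
      obtain z where z: "z \<in> F" "A \<times> {b} \<subseteq> \<phi> z \<union> flip (\<phi> z)"
        using covA[OF A] by blast
      have "slice Z b \<inter> A = slice (A \<times> {b} \<inter> Z) b"
        by auto
      also have "\<dots> = slice (A \<times> {b} \<inter> \<phi> z) b"
        by (simp add: trace[OF z])
      also have "A \<times> {b} \<inter> \<phi> z \<in> signed_sets R"
        using z Fc A by (intro Int_signed times_signed phi_signed) auto
      then have "slice (A \<times> {b} \<inter> \<phi> z) b \<in> R"
        by (simp add: signed_sets_def)
      finally show ?thesis .
    qed
    moreover have "slice Z b \<subseteq> \<Union>R"
    proof
      fix p assume "p \<in> slice Z b"
      then obtain x where "x \<in> F" "(p, b) \<in> \<phi> x"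
        by (auto simp: Z_def)
      then show "p \<in> \<Union>R"
        using Fc local_signed_support[OF phi_local] by blast
    qed
    ultimately show ?thesis
      by (auto simp: local_sets_def)
  qed
  then have "Z \<in> local_signed"
    using cons by (simp add: signed_sets_def)
  moreover have "spanning Z"
    unfolding spanning_def
  proof (intro ballI allI)
    fix p b assume "p \<in> \<Union>R"
    then obtain A where q: "A \<in> R" "p \<in> A"
      by auto
    then obtain z where "z \<in> F" "A \<times> {b} \<subseteq> \<phi> z \<union> flip (\<phi> z)"
      using covA by blast
    then show "(p, b) \<in> Z \<or> (p, \<not> b) \<in> Z"
      using q by (auto simp: Z_def)
  qed
  moreover have "F = filter_of Z"
  proof
    show "F \<subseteq> filter_of Z"
      using Fc by (auto simp: filter_of_def Z_def)
    show "filter_of Z \<subseteq> F"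
    proof
      fix x assume "x \<in> filter_of Z"
      then have x: "x \<in> carrier L" "\<phi> x \<subseteq> Z"
        by (auto simp: filter_of_def)
      then obtain z where z: "z \<in> F" "\<phi> x \<subseteq> \<phi> z \<union> flip (\<phi> z)"
        using cover by blast
      then have "\<phi> x \<subseteq> \<phi> z"
        using trace[OF z] x by blast
      then show "x \<in> F"
        using up[OF z(1)] z(1) x Fc by (auto simp: le_iff_phi)
    qed
  qed
  ultimately show ?thesis
    by (rule that)
qed

text \<open>The unsigned points form a local set, so one sign can be given to all of them at once.\<close>

lemma spanning_extension:
  assumes Z: "Z \<in> local_signed"
  obtains W where "W \<in> local_signed" "spanning W" "Z \<subseteq> W"
proof -
  define U where "U = \<Union>R - slice Z True - slice Z False"
  have "U \<in> local_sets R"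
    using Z Union_local unfolding U_def by (intro loc.Diff) (auto simp: signed_sets_def)
  then have "U \<times> {True} \<in> local_signed"
    by (rule loc.times_signed)
  moreover have "consistent (Z \<union> U \<times> {True})"
    using signed_setsD[OF Z, of _ True] by (auto simp: consistent_def all_bool_eq U_def)
  ultimately have "Z \<union> U \<times> {True} \<in> local_signed"
    using Z by (intro loc.Un_signed)
  moreover have "spanning (Z \<union> U \<times> {True})"
    unfolding spanning_def
  proof (intro ballI allI)
    fix p b assume "p \<in> \<Union>R"
    then show "(p, b) \<in> Z \<union> U \<times> {True} \<or> (p, \<not> b) \<in> Z \<union> U \<times> {True}"
      by (cases b) (auto simp: U_def)
  qed
  ultimately show ?thesis
    using that by blast
qed

lemma spanning_maximal:
  assumes Z: "Z \<in> local_signed" and "spanning Z" and W: "W \<in> local_signed" and "Z \<subseteq> W"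
  shows "W = Z"
proof
  show "W \<subseteq> Z"
  proof
    fix q assume q: "q \<in> W"
    obtain p b where pb: "q = (p, b)"
      by (cases q)
    have "p \<in> \<Union>R"
      using q W local_signed_support unfolding pb by blast
    then have "(p, b) \<in> Z \<or> (p, \<not> b) \<in> Z"
      using \<open>spanning Z\<close> unfolding spanning_def by blast
    then show "q \<in> Z"
      using signed_setsD[OF W, of p b] q \<open>Z \<subseteq> W\<close> by (auto simp: pb)
  qed
qed fact

section \<open>Boolean filters\<close>

lemma boolean_filter_filter_of:
  assumes Z: "Z \<in> local_signed"
  shows "boolean_filter L (filter_of Z)"
  unfolding boolean_filter_def
proof (intro conjI allI impI)
  show "cubic_filter L (filter_of Z)"
    using Z by (rule cubic_filter_filter_of)
  obtain W where "W \<in> local_signed" "spanning W" "Z \<subseteq> W"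
    using spanning_extension[OF Z] .
  then show "\<exists>H. g_filter L H \<and> filter_of Z \<subseteq> H"
    using g_filter_filter_of filter_of_subset_iff[OF Z] by blast
  fix H assume H: "g_filter L H \<and> filter_of Z \<subseteq> H"
  then obtain W where "W \<in> local_signed" "H = filter_of W"
    using g_filter_obtain_spanning by blast
  then show "relatively_boolean L H (filter_of Z)"
    using Z H by (simp add: filter_of_subset_iff relatively_boolean_filter_of)
qed

text \<open>One g-filter above \<open>G\<close>, given by \<open>W\<close>, suffices. Each element below \<open>W\<close> is a meet of an element of \<open>G\<close>
  and one disjoint from \<open>G\<close>, so the union \<open>Z\<close> of \<open>G\<close> cuts members of \<open>R\<close> in members of \<open>R\<close>, and an
  element below \<open>Z\<close> coincides with its component in \<open>G\<close>.\<close>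

lemma boolean_filter_obtain:
  assumes G: "boolean_filter L G"
  obtains Z where "Z \<in> local_signed" "G = filter_of Z"
proof -
  obtain H where "g_filter L H" "relatively_boolean L H G"
    using G by (auto simp: boolean_filter_def)
  moreover from this obtain W where W: "W \<in> local_signed" and "H = filter_of W"
    using g_filter_obtain_spanning by metis
  ultimately have GW: "G \<subseteq> filter_of W"
    and eq: "filter_join L G (filter_imp L G (filter_of W)) = filter_of W"
    by (auto simp: relatively_boolean_def)
  have Gc: "G \<subseteq> carrier L"
    using GW by (auto simp: filter_of_def)
  define Z where "Z = (\<Union>g\<in>G. \<phi> g)"
  have ZW: "Z \<subseteq> W"
    using GW by (auto simp: Z_def filter_of_def)
  \<comment> \<open>The decomposition \<open>x = g \<sqinter> h\<close> splits \<open>\<phi> x\<close> along \<open>Z\<close>, since \<open>\<phi> h\<close> misses all of \<open>G\<close>.\<close>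
  have split: "\<exists>g\<in>G. \<phi> x \<inter> Z = \<phi> g" if x: "x \<in> filter_of W" for x
  proof -
    from x have "x \<in> filter_join L G (filter_imp L G (filter_of W))"
      by (simp add: eq)
    then obtain g h where gh: "g \<in> G" "h \<in> filter_imp L G (filter_of W)" "is_glb L x {g, h}"
      by (auto simp: filter_join_def)
    have h: "h \<in> carrier L" "\<And>k. k \<in> G \<Longrightarrow> h \<squnion> k = \<top>"
      using gh by (auto simp: filter_imp_def filter_of_def)
    have "\<phi> h \<inter> \<phi> k = {}" if "k \<in> G" for k
      using h Gc that phi_join[of h k] phi_top_iff[of \<top>] by auto
    then have "\<phi> h \<inter> Z = {}"
      by (auto simp: Z_def)
    moreover have "\<phi> x = \<phi> g \<union> \<phi> h"
      using gh h Gc phi_glb_iff[of g h x] by auto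
    moreover have "\<phi> g \<subseteq> Z"
      using gh by (auto simp: Z_def)
    ultimately have "\<phi> x \<inter> Z = \<phi> g"
      by blast
    then show ?thesis
      using gh by blast
  qed
  have "slice Z b \<in> local_sets R" for b
  proof -
    have "slice Z b \<inter> A \<in> R" if A: "A \<in> R" for A
    proof -
      obtain x where x: "x \<in> carrier L" "\<phi> x = A \<times> {b} \<inter> W"
        using phi_surj Int_local_signed[OF times_signed[OF A] W] by blast
      then have "x \<in> filter_of W"
        by (auto simp: filter_of_def)
      then obtain g where g: "g \<in> G" "\<phi> x \<inter> Z = \<phi> g"
        using split by blast
      have "slice Z b \<inter> A = slice (\<phi> g) b"
        using ZW x by (auto simp flip: g(2))
      then show ?thesis
        using g Gc phi_signed[of g] by (auto simp: signed_sets_def)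
    qed
    moreover have "slice Z b \<subseteq> slice W b"
      using ZW by auto
    then have "slice Z b \<subseteq> \<Union>R"
      using W by (auto simp: signed_sets_def local_sets_def)
    ultimately show ?thesis
      by (auto simp: local_sets_def)
  qed
  then have "Z \<in> local_signed"
    using consistent_subset[OF signed_consistent[OF W] ZW] by (simp add: signed_sets_def)
  moreover have "G = filter_of Z"
  proof
    show "G \<subseteq> filter_of Z"
      using Gc by (auto simp: filter_of_def Z_def)
    show "filter_of Z \<subseteq> G"
    proof
      fix x assume "x \<in> filter_of Z"
      then have x: "x \<in> carrier L" "\<phi> x \<subseteq> Z"
        by (auto simp: filter_of_def)
      then have "x \<in> filter_of W"
        using ZW by (auto simp: filter_of_def)
      then obtain g where "g \<in> G" "\<phi> x \<inter> Z = \<phi> g"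
        using split by blast
      moreover from this have "x = g"
        using x Gc by (intro phi_eqD) auto
      ultimately show "x \<in> G"
        by simp
    qed
  qed
  ultimately show ?thesis
    by (rule that)
qed

end

section \<open>The algebra of Boolean filters\<close>

lemma boolean_filter_algebra_simps [simp]:
  "carrier (boolean_filter_algebra L) = {G. boolean_filter L G}"
  "eq (boolean_filter_algebra L) = (=)"
  "le (boolean_filter_algebra L) F G \<longleftrightarrow> G \<subseteq> F"
  "\<Delta>\<^bsub>boolean_filter_algebra L\<^esub> F G = filter_Delta L F G"
  by (simp_all add: boolean_filter_algebra_def)

context signed_representation
begin

lemma boolean_filter_iff: "boolean_filter L G \<longleftrightarrow> (\<exists>Z\<in>local_signed. G = filter_of Z)"
  using boolean_filter_filter_of boolean_filter_obtain by metis

text \<open>The Boolean filters form the same kind of algebra as the filter algebra itself, with the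
  ring of local sets in place of \<open>R\<close>.\<close>

lemma cubic_order_iso_filter_of:
  "cubic_order_iso (signed_algebra (local_sets R)) (boolean_filter_algebra L) filter_of"
proof
  show "bij_betw filter_of (carrier (signed_algebra (local_sets R)))
      (carrier (boolean_filter_algebra L))"
    by (auto simp: bij_betw_def boolean_filter_iff intro!: inj_onI dest: filter_of_eqD)
qed (simp_all add: filter_of_subset_iff filter_Delta_filter_of loc.Delta_signed)

lemma boolean_filter_mr_algebra: "mr_algebra (boolean_filter_algebra L)"
  using cubic_order_iso.mr_algebra_transfer[OF cubic_order_iso_filter_of] loc.signed_mr_algebra
  by simp

lemma filter_of_empty: "filter_of {} = {\<top>}"
  using phi_top_iff by (auto simp: filter_of_def)

lemma boolean_filter_top: "boolean_filter L {\<top>}"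
  using boolean_filter_filter_of[OF loc.empty_signed] by (simp add: filter_of_empty)

lemma filter_of_Int: "filter_of Y \<inter> filter_of Z = filter_of (Y \<inter> Z)"
  by (auto simp: filter_of_def)

lemma boolean_filter_Int:
  "boolean_filter L G \<Longrightarrow> boolean_filter L K \<Longrightarrow> boolean_filter L (G \<inter> K)"
  using filter_of_Int loc.Int_signed unfolding boolean_filter_iff by blast

lemma boolean_filter_algebra_join:
  assumes "boolean_filter L G" "boolean_filter L K"
  shows "G \<squnion>\<^bsub>boolean_filter_algebra L\<^esub> K = G \<inter> K"
proof -
  interpret B: mr_algebra "boolean_filter_algebra L"
    by (rule boolean_filter_mr_algebra)
  have "is_lub (boolean_filter_algebra L) (G \<inter> K) {G, K}"
    using assms boolean_filter_Int by (simp add: is_lub_pair_iff)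
  then show ?thesis
    using assms by (simp add: B.join_eqI)
qed

lemma boolean_filter_algebra_top: "\<top>\<^bsub>boolean_filter_algebra L\<^esub> = {\<top>}"
proof -
  interpret B: mr_algebra "boolean_filter_algebra L"
    by (rule boolean_filter_mr_algebra)
  have "greatest (boolean_filter_algebra L) {\<top>} (carrier (boolean_filter_algebra L))"
    using boolean_filter_top by (auto simp: greatest_def boolean_filter_iff top_in_filter_of)
  then show ?thesis
    using B.top_greatest B.greatest_unique by blast
qed

lemma g_filter_iff: "g_filter L G \<longleftrightarrow> (\<exists>Z\<in>local_signed. spanning Z \<and> G = filter_of Z)"
  using g_filter_filter_of g_filter_obtain_spanning by metis

text \<open>In a cube of signed sets the minimal elements are those in which no point is left without a sign.\<close>

lemma atom_iff_g_filter: "atom (boolean_filter_algebra L) G \<longleftrightarrow> g_filter L G"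
proof
  assume G: "atom (boolean_filter_algebra L) G"
  then obtain Z where Z: "Z \<in> local_signed" "G = filter_of Z"
    by (auto simp: atom_def boolean_filter_iff)
  obtain W where W: "W \<in> local_signed" "spanning W" "Z \<subseteq> W"
    using spanning_extension[OF Z(1)] .
  have "filter_of W = G"
    using G W Z boolean_filter_filter_of by (auto simp: atom_def filter_of_subset_iff)
  then show "g_filter L G"
    using W g_filter_iff by blast
next
  assume "g_filter L G"
  then obtain Z where Z: "Z \<in> local_signed" "spanning Z" "G = filter_of Z"
    by (auto simp: g_filter_iff)
  have "filter_of W = G" if "W \<in> local_signed" "G \<subseteq> filter_of W" for W
    using Z that spanning_maximal[of Z W] by (simp add: filter_of_subset_iff)
  then show "atom (boolean_filter_algebra L) G"
    using Z(1,3) by (auto simp: atom_def boolean_filter_iff)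
qed

lemma atomic_boolean_filter_algebra: "atomic (boolean_filter_algebra L)"
  unfolding atomic_def
proof
  fix G assume "G \<in> carrier (boolean_filter_algebra L)"
  then obtain Z where Z: "Z \<in> local_signed" "G = filter_of Z"
    by (auto simp: boolean_filter_iff)
  obtain W where W: "W \<in> local_signed" "spanning W" "Z \<subseteq> W"
    using spanning_extension[OF Z(1)] .
  then have "atom (boolean_filter_algebra L) (filter_of W)" "G \<subseteq> filter_of W"
    using Z by (simp_all add: atom_iff_g_filter g_filter_filter_of filter_of_subset_iff)
  then show "\<exists>a. atom (boolean_filter_algebra L) a \<and> a \<sqsubseteq>\<^bsub>boolean_filter_algebra L\<^esub> G"
    by auto
qed

lemma boolean_filter_Delta:
  assumes "boolean_filter L G" "boolean_filter L F" "G \<subseteq> F"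
  shows "boolean_filter L (filter_Delta L G F)"
proof -
  interpret B: mr_algebra "boolean_filter_algebra L"
    by (rule boolean_filter_mr_algebra)
  show ?thesis
    using B.Delta_closed[of F G] assms by simp
qed

lemma up_set_eq_filter_of: "g \<in> carrier L \<Longrightarrow> up_set L g = filter_of (\<phi> g)"
  by (auto simp: up_set_def filter_of_def le_iff_phi)

lemma full_embedding_up_set:
  "full_cubic_embedding L (boolean_filter_algebra L) (\<lambda>g. up_set L g)"
proof -
  have bf: "boolean_filter L (up_set L g)" if "g \<in> carrier L" for g
    using that by (simp add: up_set_eq_filter_of boolean_filter_filter_of phi_local)
  have "inj_on (up_set L) (carrier L)"
    using filter_of_eqD phi_local phi_eqD by (auto simp: up_set_eq_filter_of intro!: inj_onI)
  moreover have "up_set L \<top> = {\<top>}"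
    using phi_top_iff[of \<top>] by (simp add: up_set_eq_filter_of filter_of_empty)
  moreover have "up_set L (x \<squnion> y) = up_set L x \<inter> up_set L y"
    if "x \<in> carrier L" "y \<in> carrier L" for x y
    using that by (simp add: up_set_eq_filter_of phi_join filter_of_Int)
  moreover have "up_set L (\<Delta> y x) = filter_Delta L (up_set L y) (up_set L x)"
    if "x \<in> carrier L" "y \<in> carrier L" "x \<sqsubseteq> y" for x y
    using that by (simp add: up_set_eq_filter_of Delta_closed phi_Delta filter_Delta_filter_of phi_local)
  ultimately have "cubic_embedding L (boolean_filter_algebra L) (\<lambda>g. up_set L g)"
    using bf by (simp add: cubic_embedding_def boolean_filter_algebra_top boolean_filter_algebra_join)
  moreover have "\<exists>l\<in>carrier L. l \<sqsubset> \<top> \<and> up_set L l \<subseteq> G"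
    if G: "boolean_filter L G" "G \<noteq> {\<top>}" for G
  proof -
    obtain Z where Z: "G = filter_of Z"
      using G boolean_filter_iff by blast
    then obtain l where l: "l \<in> carrier L" "\<phi> l \<subseteq> Z" "l \<noteq> \<top>"
      using G(2) top_in_filter_of by (auto simp: filter_of_def)
    then have "l \<sqsubset> \<top>" "up_set L l \<subseteq> G"
      by (simp_all add: lless_eq Z up_set_eq_filter_of filter_of_subset_iff phi_local)
    then show ?thesis
      using l by blast
  qed
  ultimately show ?thesis
    by (auto simp: full_cubic_embedding_def boolean_filter_algebra_top lless_def)
qed

end

text \<open>The pair algebra has to be known to be a semilattice before \<open>f\<close> can be used as an order
  isomorphism; this is read off its signed representation.\<close>

lemma filter_algebra_signed_representation:
  assumes "filter_algebra TYPE('i) L"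
  obtains R :: "'i set set set" and \<phi> where "signed_representation UNIV R L \<phi>"
proof -
  have L: "cubic_algebra L"
    using assms by (simp add: filter_algebra_def)
  obtain I :: "'i gorder" and f where "implication_lattice I" and f: "cubic_iso L (pair_algebra I) f"
    using assms by (auto simp: filter_algebra_def)
  interpret I: implication_lattice I by fact
  let ?R = "I.stone ` carrier I"
  interpret R: ring_of_sets UNIV ?R
    by (rule I.ring_of_sets_stone)
  have s: "cubic_order_iso (pair_algebra I) (signed_algebra ?R) I.signed_stone"
    by (rule I.cubic_order_iso_signed_stone)
  have "eq (pair_algebra I) = (=)"
    by (simp add: pair_algebra_def)
  then have "upper_semilattice (pair_algebra I)"
    by (rule cubic_order_iso.upper_semilattice_transfer[OF cubic_order_iso.inverse[OF s]
          R.signed_upper_semilattice])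
  then have "cubic_order_iso L (pair_algebra I) f"
    using L f by (intro cubic_order_iso_of_cubic_iso)
  then have "cubic_order_iso L (signed_algebra ?R) (I.signed_stone \<circ> f)"
    using s by (rule cubic_order_iso_comp)
  then show ?thesis
    using that R.ring_of_sets_axioms L by (auto simp: signed_representation_def)
qed

theorem theorem5p42:
  fixes L :: "'a cubic"
  assumes "filter_algebra TYPE('i) L"
  shows
    "({\<top>\<^bsub>L\<^esub>} \<in> carrier (boolean_filter_algebra L) \<and>
      (\<forall>G\<in>carrier (boolean_filter_algebra L). \<forall>K\<in>carrier (boolean_filter_algebra L).
         G \<inter> K \<in> carrier (boolean_filter_algebra L)) \<and>
      (\<forall>G\<in>carrier (boolean_filter_algebra L). \<forall>F\<in>carrier (boolean_filter_algebra L).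
         G \<subseteq> F \<longrightarrow> filter_Delta L G F \<in> carrier (boolean_filter_algebra L))) \<and>
     (mr_algebra (boolean_filter_algebra L) \<and>
      atomic (boolean_filter_algebra L) \<and>
      \<top>\<^bsub>boolean_filter_algebra L\<^esub> = {\<top>\<^bsub>L\<^esub>} \<and>
      (\<forall>G\<in>carrier (boolean_filter_algebra L). \<forall>K\<in>carrier (boolean_filter_algebra L).
         G \<squnion>\<^bsub>boolean_filter_algebra L\<^esub> K = G \<inter> K)) \<and>
     full_cubic_embedding L (boolean_filter_algebra L) (\<lambda>g. up_set L g) \<and>
     {G. atom (boolean_filter_algebra L) G} = {G. g_filter L G}"
proof -
  obtain R :: "'i set set set" and \<phi> where "signed_representation UNIV R L \<phi>"
    using filter_algebra_signed_representation[OF assms] .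
  then interpret signed_representation UNIV R L \<phi> .
  show ?thesis
    using boolean_filter_top boolean_filter_Int boolean_filter_Delta boolean_filter_mr_algebra
      atomic_boolean_filter_algebra boolean_filter_algebra_top boolean_filter_algebra_join
      full_embedding_up_set atom_iff_g_filter
    by simp
qed

end
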